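(* Let $n\ge1$ and let $\mathbb T$ be the torus. The BNS invariant $\Sigma^1(P_n(\mathbb T))$ and its complement $\Sigma^1(P_n(\mathbb T))^c$ are invariant under all permutations in $S(P_n(\mathbb T))$ of the form $$(y_1,\dots,y_n)\times(x_1,\dots,x_n)\mapsto(y_{\tau(1)},\dots,y_{\tau(n)})\times(x_{\tau(1)},\dots,x_{\tau(n)}),\qquad \tau\in S_n.$$
   Context: **Pure braid groups and coordinates.** $F_n(\mathbb T)=\{(x_1,\dots,x_n)\in \mathbb T^n : x_i\ne x_j\text{ for }i\ne j\}$ and $P_n(\mathbb T)=\pi_1(F_n(\mathbb T))$. Write $\pi_1(\mathbb T)=\langle a,b\mid ab=ba\rangle$. For $1\le i\le n$, $a_i$ (resp. $b_i$) $\in P_n(\mathbb T)$ is the pure braid in which only the $i$-th string is non-trivial, this string running once along a loop representing $a$ (resp. $b$) and avoiding the other base points. The classes of $a_1,b_1,\dots,a_n,b_n$ form a basis of the free abelian group $P_n(\mathbb T)^{Ab}$, and $S(P_n(\mathbb T))$ is identified with $\mathbb S^{2n-1}$ by sending $[\chi]$ to the normalization of $(y_1,\dots,y_n)\times(x_1,\dots,x_n)=(\chi(a_1),\dots,\chi(a_n))\times(\chi(b_1),\dots,\chi(b_n))$. **BNS invariant.** For a finitely generated group $G$, the character sphere is $S(G)=(\mathrm{Hom}(G,\mathbb R)\setminus\{0\})/\sim$, where $\chi\sim\chi'$ iff $\chi'=r\chi$ for some real $r>0$; the class of $\chi$ is $[\chi]$. Fix a finite generating set $X$ of $G$ and let $\Gamma$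 be the Cayley graph with vertex set $G$ and edges joining $g$ to $gz$, $z\in X^{\pm1}$. For a nonzero $\chi$ let $\Gamma_\chi$ be the full subgraph of $\Gamma$ on the vertices $g$ with $\chi(g)\ge 0$. Then $\Sigma^1(G)=\{[\chi]\in S(G) : \Gamma_\chi \text{ is connected}\}$ (independent of $X$), and $\Sigma^1(G)^c=S(G)\setminus\Sigma^1(G)$. *)

theory Defs
  imports "HOL-Analysis.Analysis" "HOL-Algebra.Generated_Groups"
begin

section \<open>The fundamental group\<close>

definition based_loops :: "'a::topological_space set \<Rightarrow> 'a \<Rightarrow> (real \<Rightarrow> 'a) set" where
  "based_loops S p = {g. path g \<and> path_image g \<subseteq> S \<and> pathstart g = p \<and> pathfinish g = p}"

definition loop_class :: "'a::topological_space set \<Rightarrow> (real \<Rightarrow> 'a) \<Rightarrow> (real \<Rightarrow> 'a) set" where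
  "loop_class S g = {h. homotopic_paths S g h}"

definition fundamental_group :: "'a::topological_space set \<Rightarrow> 'a \<Rightarrow> (real \<Rightarrow> 'a) set monoid" where
  "fundamental_group S p =
     \<lparr> carrier = loop_class S ` based_loops S p,
       monoid.mult = (\<lambda>A B. {h. \<exists>f\<in>A. \<exists>g\<in>B. homotopic_paths S (f +++ g) h}),
       one = loop_class S (\<lambda>_. p) \<rparr>"

section \<open>The character sphere and the BNS invariant\<close>

definition real_group :: "real monoid" where
  "real_group = \<lparr> carrier = UNIV, monoid.mult = (+), one = 0 \<rparr>"

definition nonzero_characters :: "('a, 'b) monoid_scheme \<Rightarrow> ('a \<Rightarrow> real) set" where
  "nonzero_characters G = {\<phi> \<in> hom G real_group. \<exists>g\<in>carrier G. \<phi> g \<noteq> 0}"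

(* Characters are compared on carrier G only, so functions that differ merely outside
   the carrier lie in the same class. *)
definition character_rel :: "('a, 'b) monoid_scheme \<Rightarrow> (('a \<Rightarrow> real) \<times> ('a \<Rightarrow> real)) set" where
  "character_rel G = {(\<phi>, \<phi>'). \<phi> \<in> nonzero_characters G \<and> \<phi>' \<in> nonzero_characters G \<and>
     (\<exists>r>0. \<forall>g\<in>carrier G. \<phi>' g = r * \<phi> g)}"

definition character_sphere :: "('a, 'b) monoid_scheme \<Rightarrow> ('a \<Rightarrow> real) set set" where
  "character_sphere G = nonzero_characters G // character_rel G"

definition cayley_edges :: "('a, 'b) monoid_scheme \<Rightarrow> 'a set \<Rightarrow> ('a \<times> 'a) set" where
  "cayley_edges G X =
     {(g, g \<otimes>\<^bsub>G\<^esub> z) | g z. g \<in> carrier G \<and> z \<in> X \<union> (\<lambda>x. inv\<^bsub>G\<^esub> x) ` X}"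

(* The edge set E is expected to be symmetric. *)
definition full_subgraph_connected :: "('a \<times> 'a) set \<Rightarrow> 'a set \<Rightarrow> bool" where
  "full_subgraph_connected E V \<longleftrightarrow> (\<forall>u\<in>V. \<forall>v\<in>V. (u, v) \<in> (E \<inter> V \<times> V)\<^sup>*)"

definition BNS_Sigma1 :: "('a, 'b) monoid_scheme \<Rightarrow> 'a set \<Rightarrow> ('a \<Rightarrow> real) set set" where
  "BNS_Sigma1 G X = {character_rel G `` {\<phi>} | \<phi>. \<phi> \<in> nonzero_characters G \<and>
     full_subgraph_connected (cayley_edges G X) {g \<in> carrier G. \<phi> g \<ge> 0}}"

section \<open>Pure braids on the torus\<close>

definition torus :: "(complex \<times> complex) set" where
  "torus = sphere 0 1 \<times> sphere 0 1"

definition config_space :: "'a set \<Rightarrow> ('a ^ 'n) set" where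
  "config_space S = {x. (\<forall>i. x $ i \<in> S) \<and> (\<forall>i j. i \<noteq> j \<longrightarrow> x $ i \<noteq> x $ j)}"

definition pure_braid_group ::
    "(complex \<times> complex) ^ 'n \<Rightarrow> (real \<Rightarrow> (complex \<times> complex) ^ 'n) set monoid" where
  "pure_braid_group p = fundamental_group (config_space torus) p"

(* The two standard generators of the fundamental group of the torus, translated to
   the base point q; that group being abelian, this is the canonical change of base point. *)
definition torus_loop_a :: "complex \<times> complex \<Rightarrow> real \<Rightarrow> complex \<times> complex" where
  "torus_loop_a q = (\<lambda>t. (fst q * cis (2 * pi * t), snd q))"

definition torus_loop_b :: "complex \<times> complex \<Rightarrow> real \<Rightarrow> complex \<times> complex" where
  "torus_loop_b q = (\<lambda>t. (fst q, snd q * cis (2 * pi * t)))"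

(* g is a loop at the i-th base point which represents the class of the loop l in the
   torus and avoids the other base points. *)
definition string_loop ::
    "(complex \<times> complex) ^ 'n \<Rightarrow> 'n \<Rightarrow> (real \<Rightarrow> complex \<times> complex) \<Rightarrow>
     (real \<Rightarrow> complex \<times> complex) \<Rightarrow> bool" where
  "string_loop p i l g \<longleftrightarrow>
     g \<in> based_loops (torus - {p $ j | j. j \<noteq> i}) (p $ i) \<and> homotopic_paths torus l g"

definition single_string_braid ::
    "(complex \<times> complex) ^ 'n \<Rightarrow> 'n \<Rightarrow> (real \<Rightarrow> complex \<times> complex) \<Rightarrow>
     (real \<Rightarrow> (complex \<times> complex) ^ 'n) set" where
  "single_string_braid p i g =
     loop_class (config_space torus) (\<lambda>t. \<chi> j. if j = i then g t else p $ j)"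

section \<open>Coordinates on the character sphere\<close>

definition permute_coords ::
    "('n \<Rightarrow> 'n) \<Rightarrow> (real ^ 'n) \<times> (real ^ 'n) \<Rightarrow> (real ^ 'n) \<times> (real ^ 'n)" where
  "permute_coords \<tau> v = ((\<chi> i. fst v $ \<tau> i), (\<chi> i. snd v $ \<tau> i))"

(* Here c is a class of characters; the normalized vector is the same for all its
   members, so the image under the inner function is a singleton. The norm on the
   product type is the Euclidean one. *)
definition sphere_coords ::
    "('n \<Rightarrow> 'a) \<Rightarrow> ('n \<Rightarrow> 'a) \<Rightarrow> ('a \<Rightarrow> real) set \<Rightarrow> (real ^ 'n) \<times> (real ^ 'n)" where
  "sphere_coords a b c =
     the_elem ((\<lambda>f. sgn ((\<chi> i. f (a i)), (\<chi> i. f (b i)))) ` c)"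

(* The self-map of the character sphere given by permute_coords when the character sphere
   is identified with the unit sphere by sphere_coords; the latter is a bijection when the
   classes of the a i and b i form a basis of the abelianization of G. *)
definition permute_character_sphere ::
    "('a, 'b) monoid_scheme \<Rightarrow> ('n::finite \<Rightarrow> 'a) \<Rightarrow> ('n \<Rightarrow> 'a) \<Rightarrow> ('n \<Rightarrow> 'n) \<Rightarrow>
     ('a \<Rightarrow> real) set \<Rightarrow> ('a \<Rightarrow> real) set" where
  "permute_character_sphere G a b \<tau> c =
     inv_into (character_sphere G) (sphere_coords a b) (permute_coords \<tau> (sphere_coords a b c))"

end

theory Submission
  imports Defs "HOL-Complex_Analysis.Complex_Analysis" "HOL-Library.Real_Mod"
begin

text \<open>Permuting the strings is a homeomorphism of the configuration space; composed with a change
  of base point it is an automorphism of the pure braid group, and the BNS invariant is invariant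
  under automorphisms. The automorphism acts on characters by permuting coordinates because every
  character is a combination of the winding numbers of the strings, i.e. is determined by its values
  on the \<open>a i\<close> and \<open>b i\<close>.

  To see the latter, pull a character back to a cocycle on the cover of the configuration space by
  the collision-free pairs of vectors \<open>(x, y)\<close>. Between generic points one can move first all
  \<open>x\<close>-coordinates and then all \<open>y\<close>-coordinates without collisions, so the cocycle has a potential
  as soon as it vanishes on the boundaries of all rectangles with generic corners. If string \<open>i\<close>
  moves horizontally and string \<open>j \<noteq> i\<close> vertically, a full period in both directions bounds zero by
  translation invariance and contains exactly one collision, so each collision contributes zero.
  A vertical motion of \<open>i\<close> itself is a parallel motion of all strings corrected by vertical
  motions of the others.\<close>

unbundle no Formal_Power_Series.fps_syntax

section \<open>Epimorphisms and the BNS invariant\<close>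

text \<open>Two obstacles shape the argument. An automorphism carries \<open>X\<close> to another
  generating set, whereas \<open>BNS_Sigma1 G X\<close> refers to one fixed \<open>X\<close>; so the
  transport of connectivity has to include a change of generators. And
  \<open>permute_character_sphere\<close> is built from \<open>inv_into\<close>, so its values
  cannot be computed before \<open>sphere_coords\<close> is known to be injective on the character
  sphere; this is one place where the values at the \<open>a i\<close> and \<open>b i\<close> have
  to determine a character. No presentation of the pure braid group enters. Generic points make
  straight moves safe: as long as the y-coordinates are pairwise distinct modulo 1, the
  x-coordinates may move arbitrarily, and conversely. The potential itself need not be periodic, but
  a given lattice translation changes it by the same amount at every point, and this amount is
  additive in the lattice vector. Since a loop lifts to a path whose displacement is the vector of
  its winding numbers, path independence upstairs becomes a linear formula in the winding numbers
  downstairs.\<close>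

lemma hom_real_group_iff:
  "\<phi> \<in> hom G real_group \<longleftrightarrow>
     (\<forall>x\<in>carrier G. \<forall>y\<in>carrier G. \<phi> (x \<otimes>\<^bsub>G\<^esub> y) = \<phi> x + \<phi> y)"
  by (auto simp: hom_def real_group_def)

lemma
  assumes "group G" "\<phi> \<in> hom G real_group"
  shows character_one: "\<phi> \<one>\<^bsub>G\<^esub> = 0"
    and character_inv: "x \<in> carrier G \<Longrightarrow> \<phi> (inv\<^bsub>G\<^esub> x) = - \<phi> x"
proof -
  interpret group G by fact
  have mul: "\<phi> (x \<otimes>\<^bsub>G\<^esub> y) = \<phi> x + \<phi> y" if "x \<in> carrier G" "y \<in> carrier G" for x y
    using assms(2) that by (auto simp: hom_real_group_iff)
  show 1: "\<phi> \<one>\<^bsub>G\<^esub> = 0"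
    using mul[of "\<one>\<^bsub>G\<^esub>" "\<one>\<^bsub>G\<^esub>"] by simp
  show "\<phi> (inv\<^bsub>G\<^esub> x) = - \<phi> x" if "x \<in> carrier G"
    using mul[of "inv\<^bsub>G\<^esub> x" x] that 1 by simp
qed

lemma rtrancl_map:
  assumes "(u, v) \<in> R\<^sup>*" "\<And>x y. (x, y) \<in> R \<Longrightarrow> (f x, f y) \<in> S\<^sup>*"
  shows "(f u, f v) \<in> S\<^sup>*"
  using assms(1) by induction (auto intro: assms(2) rtrancl_trans)

locale character_graph = group G for G (structure) +
  fixes Y :: "'a set" and \<psi> :: "'a \<Rightarrow> real"
  assumes Y: "Y \<subseteq> carrier G" "generate G Y = carrier G"
    and \<psi>: "\<psi> \<in> nonzero_characters G"
begin

abbreviation half :: "real \<Rightarrow> 'a set" where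
  "half c \<equiv> {g \<in> carrier G. \<psi> g \<ge> c}"

text \<open>The level is a parameter because a word in \<open>Y\<close> that replaces an edge may
  dip below its starting level; only the depth of the dip is under control.\<close>

definition reach :: "real \<Rightarrow> ('a \<times> 'a) set" where
  "reach c = (cayley_edges G Y \<inter> half c \<times> half c)\<^sup>*"

lemma char_mult: "x \<in> carrier G \<Longrightarrow> y \<in> carrier G \<Longrightarrow> \<psi> (x \<otimes> y) = \<psi> x + \<psi> y"
  using \<psi> by (auto simp: nonzero_characters_def hom_real_group_iff)

lemma char_one: "\<psi> \<one> = 0" and char_inv: "x \<in> carrier G \<Longrightarrow> \<psi> (inv x) = - \<psi> x"
  using \<psi> character_one[OF is_group] character_inv[OF is_group] by (auto simp: nonzero_characters_def)

lemma gens_carrier: "z \<in> Y \<union> (\<lambda>x. inv x) ` Y \<Longrightarrow> z \<in> carrier G"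
  using Y by auto

lemma reach_refl: "(g, g) \<in> reach c"
  by (simp add: reach_def)

lemma reach_trans: "(g, h) \<in> reach c \<Longrightarrow> (h, k) \<in> reach c \<Longrightarrow> (g, k) \<in> reach c"
  unfolding reach_def by (rule rtrancl_trans)

lemma reach_step:
  assumes "g \<in> carrier G" "z \<in> Y \<union> (\<lambda>x. inv x) ` Y" "c \<le> \<psi> g" "c \<le> \<psi> (g \<otimes> z)"
  shows "(g, g \<otimes> z) \<in> reach c"
  using assms gens_carrier[OF assms(2)] unfolding reach_def cayley_edges_def by blast

lemma reach_sym:
  assumes "(g, h) \<in> reach c" shows "(h, g) \<in> reach c"
  using assms unfolding reach_def
proof (induction rule: rtrancl_induct)
  case (step h k)
  then obtain z where z: "h \<in> carrier G" "k = h \<otimes> z" "z \<in> Y \<union> (\<lambda>x. inv x) ` Y" "h \<in> half c" "k \<in> half c"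
    by (auto simp: cayley_edges_def)
  have zc: "z \<in> carrier G" using gens_carrier z by blast
  have "inv z \<in> Y \<union> (\<lambda>x. inv x) ` Y"
    using z(3) Y(1) by auto
  moreover have "h = k \<otimes> inv z"
    using z zc by (simp add: m_assoc)
  ultimately have "(k, h) \<in> reach c"
    using reach_step[of k "inv z" c] z by auto
  then show ?case
    using step.IH unfolding reach_def by (meson rtrancl_trans)
qed simp

text \<open>Left-multiplying a path that spells \<^term>\<open>w\<close> changes \<^term>\<open>\<psi>\<close> along it by a constant,
  so the loss \<^term>\<open>K\<close> does not depend on the starting point.\<close>
lemma reach_word:
  assumes "w \<in> carrier G"
  obtains K where "\<And>g c. g \<in> carrier G \<Longrightarrow> c \<le> \<psi> g - K \<Longrightarrow> (g, g \<otimes> w) \<in> reach c"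
proof -
  have "w \<in> generate G Y" using assms Y by simp
  then have "\<exists>K. \<forall>g c. g \<in> carrier G \<longrightarrow> c \<le> \<psi> g - K \<longrightarrow> (g, g \<otimes> w) \<in> reach c"
  proof induction
    case one
    show ?case by (auto simp: reach_refl)
  next
    case (incl h)
    show ?case
    proof (intro exI[of _ "\<bar>\<psi> h\<bar>"] allI impI)
      fix g c assume g: "g \<in> carrier G" "c \<le> \<psi> g - \<bar>\<psi> h\<bar>"
      have "h \<in> carrier G" using incl Y by auto
      then show "(g, g \<otimes> h) \<in> reach c"
        using incl g by (intro reach_step) (auto simp: char_mult)
    qed
  next
    case (inv h)
    show ?case
    proof (intro exI[of _ "\<bar>\<psi> h\<bar>"] allI impI)
      fix g c assume g: "g \<in> carrier G" "c \<le> \<psi> g - \<bar>\<psi> h\<bar>"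
      have "h \<in> carrier G" using inv Y by auto
      then show "(g, g \<otimes> inv h) \<in> reach c"
        using inv g by (intro reach_step) (auto simp: char_mult char_inv)
    qed
  next
    case (eng h k)
    then obtain K L where
      K: "\<And>g c. g \<in> carrier G \<Longrightarrow> c \<le> \<psi> g - K \<Longrightarrow> (g, g \<otimes> h) \<in> reach c" and
      L: "\<And>g c. g \<in> carrier G \<Longrightarrow> c \<le> \<psi> g - L \<Longrightarrow> (g, g \<otimes> k) \<in> reach c"
      by metis
    have hk: "h \<in> carrier G" "k \<in> carrier G"
      using eng.hyps Y by auto
    \<comment> \<open>Once \<open>h\<close> has been spelled, the level is
      \<open>\<psi> g + \<psi> h\<close>, so the budget for \<open>k\<close> must also absorb a
      possible drop by \<open>\<bar>\<psi> h\<bar>\<close>.\<close>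
    show ?case
    proof (intro exI[of _ "\<bar>K\<bar> + \<bar>L\<bar> + \<bar>\<psi> h\<bar>"] allI impI)
      fix g c assume g: "g \<in> carrier G" "c \<le> \<psi> g - (\<bar>K\<bar> + \<bar>L\<bar> + \<bar>\<psi> h\<bar>)"
      have "(g, g \<otimes> h) \<in> reach c"
        using g by (intro K) auto
      moreover have "(g \<otimes> h, g \<otimes> h \<otimes> k) \<in> reach c"
        using g hk by (intro L) (auto simp: char_mult)
      ultimately show "(g, g \<otimes> (h \<otimes> k)) \<in> reach c"
        using reach_trans g hk by (simp add: m_assoc)
    qed
  qed
  then show thesis using that by blast
qed

text \<open>A character that vanishes on \<open>Y\<close> vanishes on everything generated by
  \<open>Y\<close>. A generator with negative value is replaced by its inverse.\<close>

lemma ascending_generator: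
  obtains t where "t \<in> Y \<union> (\<lambda>x. inv x) ` Y" "\<psi> t > 0"
proof -
  have "\<exists>y\<in>Y. \<psi> y \<noteq> 0"
  proof (rule ccontr)
    assume 0: "\<not> ?thesis"
    have "\<psi> w = 0" if "w \<in> generate G Y" for w
      using that
    proof induction
      case (eng h k)
      then show ?case using Y by (simp add: char_mult)
    qed (use 0 Y in \<open>auto simp: char_one char_inv subset_iff\<close>)
    then show False using \<psi> Y by (auto simp: nonzero_characters_def)
  qed
  then obtain y where "y \<in> Y" "\<psi> y \<noteq> 0" by blast
  then show thesis
    using that[of y] that[of "inv y"] Y by (cases "\<psi> y > 0") (auto simp: char_inv subset_iff)
qed

text \<open>Each edge of the \<open>X\<close>-graph is replaced by a word in \<open>Y\<close>, which
  loses at most a bound \<open>B\<close> common to the finitely many edge labels. To afford this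
  loss, both end points are first raised by right multiplication with a power \<open>s\<close> of an
  ascending generator, the connection is made at level at least \<open>B\<close>, and the climb is
  undone at the other end.\<close>

lemma connected_halfspace:
  assumes X: "finite X" "X \<subseteq> carrier G"
    and conn: "full_subgraph_connected (cayley_edges G X) (half 0)"
  shows "full_subgraph_connected (cayley_edges G Y) (half 0)"
proof -
  let ?X = "X \<union> (\<lambda>x. inv x) ` X"
  have Xc: "?X \<subseteq> carrier G" and fX: "finite ?X" using X by auto
  have "\<forall>w\<in>?X. \<exists>K. \<forall>g c. g \<in> carrier G \<longrightarrow> c \<le> \<psi> g - K \<longrightarrow> (g, g \<otimes> w) \<in> reach c"
    using Xc reach_word by (meson subsetD)
  then obtain K where
    K: "\<And>w g c. w \<in> ?X \<Longrightarrow> g \<in> carrier G \<Longrightarrow> c \<le> \<psi> g - K w \<Longrightarrow> (g, g \<otimes> w) \<in> reach c"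
    by metis
  \<comment> \<open>\<open>insert 0\<close> keeps the maximum meaningful when \<open>X\<close> is
    empty.\<close>
  define B where "B = Max (insert 0 (K ` ?X))"
  have B: "K w \<le> B" if "w \<in> ?X" for w
    unfolding B_def using fX that by (intro Max_ge) auto
  obtain t where t: "t \<in> Y \<union> (\<lambda>x. inv x) ` Y" "\<psi> t > 0"
    using ascending_generator .
  have tc: "t \<in> carrier G" using gens_carrier t by blast
  have tn: "\<psi> (t [^] n) = of_nat n * \<psi> t" for n :: nat
    using tc by (induction n) (auto simp: char_one char_mult algebra_simps)
  obtain N :: nat where N: "of_nat N * \<psi> t \<ge> B"
    using reals_Archimedean3[OF t(2)] less_imp_le by blast
  have climb: "(g, g \<otimes> t [^] n) \<in> reach 0" if g: "g \<in> half 0" for g and n :: nat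
  proof (induction n)
    case 0
    then show ?case using g by (simp add: reach_refl)
  next
    case (Suc n)
    have "(g \<otimes> t [^] n, g \<otimes> t [^] n \<otimes> t) \<in> reach 0"
      using g t tc by (intro reach_step) (auto simp: char_mult tn)
    then show ?case using Suc reach_trans g tc by (auto simp: m_assoc)
  qed
  show ?thesis
    unfolding full_subgraph_connected_def
  proof (intro ballI)
    fix u v assume u: "u \<in> half 0" and v: "v \<in> half 0"
    define s where "s = t [^] N"
    have s: "s \<in> carrier G" "\<psi> s \<ge> B" using tc tn N by (auto simp: s_def)
    \<comment> \<open>Conjugation by \<open>s\<close> does not change \<open>\<psi>\<close>, so the
      hypothesis on \<open>X\<close> applies to the conjugates. Left multiplication of the resulting
      path by \<open>s\<close> then lifts all of it by \<open>\<psi> s \<ge> B\<close> and makes it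
      run from \<open>u \<otimes> s\<close> to \<open>v \<otimes> s\<close>.\<close>
    have in_half: "inv s \<otimes> (w \<otimes> s) \<in> half 0" if "w \<in> half 0" for w
      using that s by (auto simp: char_mult char_inv)
    have "(inv s \<otimes> (u \<otimes> s), inv s \<otimes> (v \<otimes> s)) \<in> (cayley_edges G X \<inter> half 0 \<times> half 0)\<^sup>*"
      using conn in_half u v unfolding full_subgraph_connected_def by blast
    then have "(s \<otimes> (inv s \<otimes> (u \<otimes> s)), s \<otimes> (inv s \<otimes> (v \<otimes> s))) \<in>
        (cayley_edges G Y \<inter> half 0 \<times> half 0)\<^sup>*"
    proof (rule rtrancl_map)
      fix g h assume "(g, h) \<in> cayley_edges G X \<inter> half 0 \<times> half 0"
      then obtain w where w: "w \<in> ?X" "h = g \<otimes> w" "g \<in> carrier G" "\<psi> g \<ge> 0"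
        by (auto simp: cayley_edges_def)
      have "(s \<otimes> g, s \<otimes> g \<otimes> w) \<in> reach 0"
        using w s B[OF w(1)] by (intro K) (auto simp: char_mult)
      moreover have "s \<otimes> g \<otimes> w = s \<otimes> h"
        using w s Xc by (auto simp: m_assoc)
      ultimately show "(s \<otimes> g, s \<otimes> h) \<in> (cayley_edges G Y \<inter> half 0 \<times> half 0)\<^sup>*"
        by (simp add: reach_def)
    qed
    then have "(u \<otimes> s, v \<otimes> s) \<in> reach 0"
      using u v s by (simp add: m_assoc[symmetric] reach_def)
    then show "(u, v) \<in> (cayley_edges G Y \<inter> half 0 \<times> half 0)\<^sup>*"
      using climb[OF u, of N] climb[OF v, of N] reach_sym reach_trans
      unfolding s_def[symmetric] reach_def[symmetric] by blast
  qed
qed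

end

text \<open>Vertices of the half-space in \<open>H\<close> have preimages at the same level in
  \<open>G\<close>, and \<open>\<phi>\<close> maps a path between these to a path whose edges are
  labelled by images of \<open>X\<close>. What remains is the passage from these labels to
  \<open>Y\<close>.\<close>

lemma full_subgraph_connected_epimorphism:
  assumes "group G" "group H" and \<phi>: "\<phi> \<in> hom G H" "\<phi> ` carrier G = carrier H"
    and X: "finite X" "X \<subseteq> carrier G" and Y: "Y \<subseteq> carrier H" "generate H Y = carrier H"
    and \<psi>: "\<psi> \<in> nonzero_characters H"
    and conn: "full_subgraph_connected (cayley_edges G X) {g \<in> carrier G. \<psi> (\<phi> g) \<ge> 0}"
  shows "full_subgraph_connected (cayley_edges H Y) {h \<in> carrier H. \<psi> h \<ge> 0}"
proof -
  interpret \<phi>: group_hom G H \<phi>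
    using assms by (simp add: group_hom_def group_hom_axioms_def)
  interpret character_graph H Y \<psi>
    using Y \<psi> by unfold_locales
  have "full_subgraph_connected (cayley_edges H (\<phi> ` X)) (half 0)"
    unfolding full_subgraph_connected_def
  proof (intro ballI)
    fix u v assume "u \<in> half 0" "v \<in> half 0"
    then obtain u' v' where u': "u' \<in> carrier G" "u = \<phi> u'" "\<psi> u \<ge> 0"
      and v': "v' \<in> carrier G" "v = \<phi> v'" "\<psi> v \<ge> 0"
      using \<phi>(2) by (metis (no_types, lifting) imageE mem_Collect_eq)
    let ?V = "{g \<in> carrier G. \<psi> (\<phi> g) \<ge> 0}"
    have "(u', v') \<in> (cayley_edges G X \<inter> ?V \<times> ?V)\<^sup>*"
      using conn u' v' by (auto simp: full_subgraph_connected_def)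
    then have "(\<phi> u', \<phi> v') \<in> (cayley_edges H (\<phi> ` X) \<inter> half 0 \<times> half 0)\<^sup>*"
    proof (rule rtrancl_map)
      fix g h assume "(g, h) \<in> cayley_edges G X \<inter> ?V \<times> ?V"
      then obtain z where z: "g \<in> carrier G" "h = g \<otimes>\<^bsub>G\<^esub> z" "z \<in> X \<union> (\<lambda>x. inv\<^bsub>G\<^esub> x) ` X"
         "\<psi> (\<phi> g) \<ge> 0" "\<psi> (\<phi> h) \<ge> 0" "h \<in> carrier G"
        by (auto simp: cayley_edges_def)
      have "z \<in> carrier G" using z X by auto
      moreover have "\<phi> z \<in> \<phi> ` X \<union> (\<lambda>x. inv\<^bsub>H\<^esub> x) ` \<phi> ` X"
        using z(3) X(2) by (auto simp: \<phi>.hom_inv subset_iff)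
      ultimately have "(\<phi> g, \<phi> h) \<in> cayley_edges H (\<phi> ` X)"
        using z unfolding cayley_edges_def by auto
      then show "(\<phi> g, \<phi> h) \<in> (cayley_edges H (\<phi> ` X) \<inter> half 0 \<times> half 0)\<^sup>*"
        using z by auto
    qed
    then show "(u, v) \<in> (cayley_edges H (\<phi> ` X) \<inter> half 0 \<times> half 0)\<^sup>*"
      using u' v' by simp
  qed
  then show ?thesis
    using X by (intro connected_halfspace) auto
qed

section \<open>Generic and collision-free configurations\<close>

definition upd :: "'a ^ 'n \<Rightarrow> 'n \<Rightarrow> 'a \<Rightarrow> 'a ^ 'n" where
  "upd x i u = (\<chi> k. if k = i then u else x $ k)"

lemma upd_nth [simp]: "upd x i u $ k = (if k = i then u else x $ k)"
  by (simp add: upd_def)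

lemma upd_same [simp]: "upd x i (x $ i) = x"
  by (simp add: vec_eq_iff)

lemma closed_segment_upd:
  fixes x :: "real ^ 'n"
  assumes "z \<in> closed_segment (upd x i u) (upd x i v)"
  obtains w where "w \<in> closed_segment u v" "z = upd x i w"
proof -
  obtain t where t: "0 \<le> t" "t \<le> 1" and z: "z = (1 - t) *\<^sub>R upd x i u + t *\<^sub>R upd x i v"
    using assms by (auto simp: closed_segment_def)
  have "z = upd x i ((1 - t) *\<^sub>R u + t *\<^sub>R v)"
    unfolding z by (simp add: vec_eq_iff algebra_simps)
  moreover have "(1 - t) *\<^sub>R u + t *\<^sub>R v \<in> closed_segment u v"
    using t by (auto simp: closed_segment_def)
  ultimately show thesis using that by blast
qed

definition integral_vecs :: "(real ^ 'n) set" where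
  "integral_vecs = {l. \<forall>i. l $ i \<in> \<int>}"

text \<open>The coordinates stand for points of the circle of length 1, and these points are to be
  distinct.\<close>

definition generic :: "(real ^ 'n) set" where
  "generic = {x. \<forall>i j. i \<noteq> j \<longrightarrow> x $ i - x $ j \<notin> \<int>}"

lemma genericD: "x \<in> generic \<Longrightarrow> i \<noteq> j \<Longrightarrow> x $ i - x $ j \<notin> \<int>"
  by (simp add: generic_def)

text \<open>This is the preimage of the configuration space under the universal covering of the
  n-fold power of the torus, with all first coordinates collected in \<open>x\<close> and all second
  coordinates in \<open>y\<close>.\<close>

definition coll_free :: "((real ^ 'n) \<times> (real ^ 'n)) set" where
  "coll_free = {(x, y). \<forall>i j. i \<noteq> j \<longrightarrow> x $ i - x $ j \<notin> \<int> \<or> y $ i - y $ j \<notin> \<int>}"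

lemma Ints_minus_commute: "(a::real) - b \<in> \<int> \<longleftrightarrow> b - a \<in> \<int>"
  by (metis Ints_minus minus_diff_eq)

text \<open>Moving along a vector \<open>v\<close> with pairwise distinct entries changes every
  difference of coordinates at nonzero speed, so only countably many parameters are bad.\<close>

lemma generic_dense:
  fixes x :: "real ^ 'n::finite"
  assumes "e > 0"
  obtains z where "z \<in> generic" "dist z x < e"
proof -
  obtain f :: "'n \<Rightarrow> nat" where f: "inj f"
    using finite_imp_inj_to_nat_seg[of "UNIV :: 'n set"] by blast
  define v where "v = (\<chi> j. real (f j))"
  define D where "D = (\<Union>j k. (\<lambda>m. (of_int m + (x $ k - x $ j)) / (v $ j - v $ k)) ` (UNIV :: int set))"
  have "countable D" unfolding D_def by (intro countable_UN countable_image) auto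
  \<comment> \<open>The summand 1 avoids a division by zero, since \<open>v\<close> may vanish when
    there is only one string.\<close>
  define d where "d = e / (1 + norm v)"
  have "d > 0" using assms by (auto simp: d_def add_pos_nonneg)
  then have "uncountable ({0<..<d} - D)"
    using \<open>countable D\<close> by (simp add: uncountable_minus_countable uncountable_open_interval)
  then obtain s where s: "s \<in> {0<..<d}" "s \<notin> D"
    by (metis Diff_iff countable_empty equals0I)
  have "x + s *\<^sub>R v \<in> generic"
    unfolding generic_def mem_Collect_eq
  proof (intro allI impI notI)
    fix i j :: 'n assume ij: "i \<noteq> j" and "(x + s *\<^sub>R v) $ i - (x + s *\<^sub>R v) $ j \<in> \<int>"
    then obtain m where m: "x $ i + s * v $ i - (x $ j + s * v $ j) = of_int m"
      by (auto elim: Ints_cases)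
    have "v $ i - v $ j \<noteq> 0" using f ij by (auto simp: v_def inj_eq)
    then have "s = (of_int m + (x $ j - x $ i)) / (v $ i - v $ j)"
      using m by (simp add: field_simps)
    then show False using s by (auto simp: D_def)
  qed
  moreover have "dist (x + s *\<^sub>R v) x < e"
  proof -
    have "s * norm v \<le> s * (1 + norm v)" using s by (intro mult_left_mono) auto
    also have "\<dots> < d * (1 + norm v)" using s by (intro mult_strict_right_mono) (auto simp: add_pos_nonneg)
    also have "\<dots> = e"
      unfolding d_def using add_pos_nonneg[OF zero_less_one norm_ge_zero[of v]] by simp
    finally show ?thesis using s by (simp add: dist_norm)
  qed
  ultimately show thesis using that by blast
qed

lemma generic_nonempty: obtains x :: "real ^ 'n::finite" where "x \<in> generic"
  using generic_dense[of 1 0] by auto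

text \<open>The coordinates in \<open>A\<close> are switched from \<open>x\<close> to
  \<open>z\<close> one at a time. The hypothesis \<open>mix\<close> excludes coincidences between
  switched and unswitched coordinates, so every intermediate vector is generic.\<close>

lemma generic_chain_aux:
  fixes x z :: "real ^ 'n::finite"
  assumes x: "x \<in> generic" and z: "z \<in> generic"
    and agree: "\<And>k. k \<notin> A \<Longrightarrow> x $ k = z $ k"
    and mix: "\<And>j k. j \<in> A \<Longrightarrow> k \<noteq> j \<Longrightarrow> z $ j - x $ k \<notin> \<int>"
    and refl: "\<And>w. w \<in> generic \<Longrightarrow> Q w w"
    and trans: "\<And>u v w. u \<in> generic \<Longrightarrow> v \<in> generic \<Longrightarrow> w \<in> generic \<Longrightarrow> Q u v \<Longrightarrow> Q v w \<Longrightarrow> Q u w"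
    and step: "\<And>w i u. w \<in> generic \<Longrightarrow> i \<in> A \<Longrightarrow> upd w i u \<in> generic \<Longrightarrow> Q w (upd w i u)"
  shows "Q x z"
proof -
  let ?w = "\<lambda>B. (\<chi> j. if j \<in> B then z $ j else x $ j)"
  have gen: "?w B \<in> generic" if "B \<subseteq> A" for B
    unfolding generic_def
  proof (clarsimp, intro conjI impI allI)
    fix i j :: 'n assume ij: "i \<noteq> j"
    show "i \<in> B \<Longrightarrow> j \<in> B \<Longrightarrow> z $ i - z $ j \<notin> \<int>" "x $ i - x $ j \<notin> \<int>"
      using x z ij by (auto simp: generic_def)
    show "i \<in> B \<Longrightarrow> j \<notin> B \<Longrightarrow> z $ i - x $ j \<notin> \<int>"
      using mix[of i j] ij that by auto
    show "i \<notin> B \<Longrightarrow> j \<in> B \<Longrightarrow> x $ i - z $ j \<notin> \<int>"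
      using mix[of j i] ij that by (auto simp: Ints_minus_commute)
  qed
  have "Q x (?w B)" if "B \<subseteq> A" for B
    using finite[of B] that
  proof (induction B)
    case empty
    then show ?case using refl[OF x] by simp
  next
    case (insert b B)
    have "?w (insert b B) = upd (?w B) b (z $ b)"
      by (auto simp: vec_eq_iff)
    then have "Q (?w B) (?w (insert b B))"
      using step[of "?w B" b "z $ b"] gen[of B] gen[of "insert b B"] insert.prems by simp
    then show ?case
      using insert trans[OF x gen[of B] gen[of "insert b B"]] by blast
  qed
  from this[of A] show ?thesis
    using agree by (simp cong: if_cong add: vec_lambda_eta)
qed

text \<open>Switching coordinates directly from \<open>x\<close> to \<open>y\<close> can fail,
  because a new coordinate of \<open>y\<close> may agree modulo 1 with an old one of
  \<open>x\<close>. The detour through \<open>z\<close>, where the coordinates in \<open>A\<close>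
  are all shifted by the same \<open>d\<close>, avoids this at both stages.\<close>

lemma generic_chain:
  fixes x y :: "real ^ 'n::finite"
  assumes x: "x \<in> generic" and y: "y \<in> generic"
    and agree: "\<And>k. k \<notin> A \<Longrightarrow> x $ k = y $ k"
    and refl: "\<And>w. w \<in> generic \<Longrightarrow> Q w w"
    and trans: "\<And>u v w. u \<in> generic \<Longrightarrow> v \<in> generic \<Longrightarrow> w \<in> generic \<Longrightarrow> Q u v \<Longrightarrow> Q v w \<Longrightarrow> Q u w"
    and step: "\<And>w i u. w \<in> generic \<Longrightarrow> i \<in> A \<Longrightarrow> upd w i u \<in> generic \<Longrightarrow> Q w (upd w i u)"
  shows "Q x y"
proof -
  \<comment> \<open>The first family collects the shifts at which a shifted coordinate of
    \<open>x\<close> meets one of \<open>x\<close>, the second those at which it meets one of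
    \<open>y\<close>.\<close>
  define D where "D = (\<Union>j k. (\<lambda>m. of_int m + (x $ k - x $ j)) ` (UNIV :: int set) \<union>
      (\<lambda>m. of_int m + (y $ k - x $ j)) ` (UNIV :: int set))"
  have "countable D" unfolding D_def by (intro countable_UN countable_Un countable_image) auto
  then obtain d where d: "d \<notin> D"
    using uncountable_UNIV_real by (metis UNIV_eq_I)
  define z where "z = (\<chi> j. if j \<in> A then x $ j + d else x $ j)"
  have xd: "x $ j + d - x $ k \<notin> \<int>" for j k
  proof
    assume "x $ j + d - x $ k \<in> \<int>"
    then obtain m where "x $ j + d - x $ k = of_int m" by (auto elim: Ints_cases)
    then have "d = of_int m + (x $ k - x $ j)" by simp
    then show False using d by (auto simp: D_def)
  qed
  have yd: "y $ j - (x $ k + d) \<notin> \<int>" for j k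
  proof
    assume "y $ j - (x $ k + d) \<in> \<int>"
    then obtain m where "y $ j - (x $ k + d) = of_int m" by (auto elim: Ints_cases)
    then have "d = of_int (- m) + (y $ j - x $ k)" by simp
    then show False using d unfolding D_def by blast
  qed
  have z: "z \<in> generic"
    unfolding generic_def
  proof (clarsimp)
    fix i j :: 'n assume ij: "i \<noteq> j" "z $ i - z $ j \<in> \<int>"
    show False
      using ij x xd[of i j] xd[of j i] Ints_minus_commute[of "x $ i" "x $ j + d"]
      by (auto simp: z_def generic_def split: if_splits)
  qed
  have "Q x z"
    by (rule generic_chain_aux[where A = A, OF x z _ _ refl trans step])
       (auto simp: z_def xd)
  moreover have "Q z y"
  proof (rule generic_chain_aux[where A = A, OF z y _ _ refl trans step])
    show "y $ j - z $ k \<notin> \<int>" if "j \<in> A" "k \<noteq> j" for j k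
      using that y yd agree[of k] by (cases "k \<in> A") (auto simp: z_def generic_def)
  qed (auto simp: z_def agree)
  ultimately show ?thesis using trans[OF x z y] by blast
qed

section \<open>Unit cells of the line and chains of periods\<close>

lemma notin_Ints_between:
  fixes u v a w :: real
  assumes "\<lfloor>u - a\<rfloor> = \<lfloor>v - a\<rfloor>" "u - a \<notin> \<int>" "v - a \<notin> \<int>" "w \<in> closed_segment u v"
  shows "w - a \<notin> \<int>"
proof
  assume "w - a \<in> \<int>"
  then obtain m where m: "w = a + of_int m" by (auto elim!: Ints_cases simp: algebra_simps)
  have *: False if "u \<le> a + of_int m" "a + of_int m \<le> v" "\<lfloor>u - a\<rfloor> = \<lfloor>v - a\<rfloor>" "u - a \<notin> \<int>" for u v
  proof -
    have "m \<le> \<lfloor>v - a\<rfloor>" using that by (simp add: le_floor_iff)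
    then have "of_int m \<le> u - a" using that le_floor_iff by metis
    then have "u - a = of_int m" using that by simp
    then show False using that by simp
  qed
  show False
    using assms *[of u v] *[of v u] by (auto simp: m closed_segment_eq_real_ivl split: if_splits)
qed

text \<open>Adding the difference of the floors moves the lower point into the cell of the other one
  by unit steps. In the applications a unit step is a full turn of a string, and a cell is an
  interval in which it does not pass the string that it could hit.\<close>

lemma floor_period_chain:
  fixes a :: real
  assumes period: "\<And>u. u \<in> D \<Longrightarrow> u + 1 \<in> D \<and> R u (u + 1)"
    and floor: "\<And>u v. u \<in> D \<Longrightarrow> v \<in> D \<Longrightarrow> \<lfloor>u - a\<rfloor> = \<lfloor>v - a\<rfloor> \<Longrightarrow> R u v"
    and trans: "\<And>u v w. u \<in> D \<Longrightarrow> v \<in> D \<Longrightarrow> w \<in> D \<Longrightarrow> R u v \<Longrightarrow> R v w \<Longrightarrow> R u w"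
    and sym: "\<And>u v. u \<in> D \<Longrightarrow> v \<in> D \<Longrightarrow> R u v \<Longrightarrow> R v u"
    and uv: "u \<in> D" "v \<in> D"
  shows "R u v"
proof -
  have shift: "u + of_nat n \<in> D \<and> R u (u + of_nat n)" if "u \<in> D" for u and n :: nat
  proof (induction n)
    case 0
    then show ?case using that floor[of u u] by simp
  next
    case (Suc n)
    then have "u + of_nat n \<in> D" "R u (u + of_nat n)" by auto
    with period[OF this(1)] show ?case
      using trans[of u "u + of_nat n" "u + of_nat n + 1"] that by (simp add: add_ac)
  qed
  have le: "R u v" if "u \<in> D" "v \<in> D" "\<lfloor>u - a\<rfloor> \<le> \<lfloor>v - a\<rfloor>" for u v
  proof -
    define n where "n = nat (\<lfloor>v - a\<rfloor> - \<lfloor>u - a\<rfloor>)"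
    have "u + of_nat n - a = (u - a) + of_int (\<lfloor>v - a\<rfloor> - \<lfloor>u - a\<rfloor>)"
      using that by (simp add: n_def)
    then have "\<lfloor>u + of_nat n - a\<rfloor> = \<lfloor>v - a\<rfloor>"
      by (simp only: floor_add_int[symmetric])
    then show ?thesis
      using shift[of u n] floor[of "u + of_nat n" v] trans[of u "u + of_nat n" v] that by blast
  qed
  show ?thesis
    using le[of u v] le[of v u] sym[of v u] uv by linarith
qed

text \<open>One generic half of the coordinates already separates the strings, whatever the other
  half does. These slices are convex, so a cocycle is path independent on each of them.\<close>

lemma generic_prod_subset:
  "y \<in> generic \<Longrightarrow> UNIV \<times> {y} \<subseteq> coll_free" "x \<in> generic \<Longrightarrow> {x} \<times> UNIV \<subseteq> coll_free"
  by (auto simp: generic_def coll_free_def)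

lemma generic_add_const: "(\<chi> k. x $ k + c) \<in> generic \<longleftrightarrow> x \<in> generic"
  by (simp add: generic_def)

lemma generic_segment_add_const:
  assumes "x \<in> generic" "z \<in> closed_segment x (\<chi> k. x $ k + c)"
  shows "z \<in> generic"
proof -
  obtain t where t: "z = (1 - t) *\<^sub>R x + t *\<^sub>R (\<chi> k. x $ k + c)"
    using assms by (auto simp: closed_segment_def)
  have "z = (\<chi> k. x $ k + t * c)"
    unfolding t by (simp add: vec_eq_iff algebra_simps)
  then show ?thesis using assms by (simp add: generic_add_const)
qed

lemma diff_Ints_add_integral:
  assumes "l \<in> integral_vecs"
  shows "(x + l) $ i - (x + l) $ j \<in> \<int> \<longleftrightarrow> x $ i - x $ j \<in> \<int>"
proof -
  have "(x + l) $ i - (x + l) $ j = (x $ i - x $ j) + (l $ i - l $ j)" by simp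
  then show ?thesis
    using assms by (metis (no_types, lifting) Ints_add Ints_diff add_diff_cancel_right' integral_vecs_def mem_Collect_eq)
qed

lemma generic_add_integral:
  assumes "l \<in> integral_vecs"
  shows "x + l \<in> generic \<longleftrightarrow> x \<in> generic"
  using diff_Ints_add_integral[OF assms] by (simp add: generic_def del: vector_add_component)

lemma coll_free_translate:
  assumes "l \<in> integral_vecs" "m \<in> integral_vecs"
  shows "P + (l, m) \<in> coll_free \<longleftrightarrow> P \<in> coll_free"
  using diff_Ints_add_integral[OF assms(1), of "fst P"] diff_Ints_add_integral[OF assms(2), of "snd P"]
  by (cases P) (simp add: coll_free_def del: vector_add_component)

section \<open>Translation-invariant cocycles\<close>

text \<open>Modelled on a character pulled back to paths in the covering space.
  \<open>W_translate\<close> reflects that integral translates of a path have the same projection to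
  the configuration space.\<close>

locale cocycle =
  fixes W :: "(real \<Rightarrow> (real ^ 'n::finite) \<times> (real ^ 'n)) \<Rightarrow> real"
  assumes W_join: "\<lbrakk>path g; path_image g \<subseteq> coll_free; path h; path_image h \<subseteq> coll_free;
      pathfinish g = pathstart h\<rbrakk> \<Longrightarrow> W (g +++ h) = W g + W h"
    and W_homotopic: "homotopic_paths coll_free g h \<Longrightarrow> W g = W h"
    and W_translate: "\<lbrakk>path g; path_image g \<subseteq> coll_free; l \<in> integral_vecs; m \<in> integral_vecs\<rbrakk>
      \<Longrightarrow> W (\<lambda>t. g t + (l, m)) = W g"
begin

abbreviation L :: "(real ^ 'n) \<times> (real ^ 'n) \<Rightarrow> (real ^ 'n) \<times> (real ^ 'n) \<Rightarrow> real" where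
  "L P Q \<equiv> W (linepath P Q)"

text \<open>Convex sets are simply connected, so any path inside one is homotopic to the segment
  between its end points.\<close>

lemma W_convex:
  assumes "convex S" "S \<subseteq> coll_free" "path g" "path_image g \<subseteq> S"
  shows "W g = L (pathstart g) (pathfinish g)"
proof -
  have "pathstart g \<in> S" "pathfinish g \<in> S"
    using assms pathstart_in_path_image pathfinish_in_path_image by blast+
  then have "homotopic_paths S g (linepath (pathstart g) (pathfinish g))"
    using convex_imp_simply_connected[OF assms(1)] assms(3,4)
    by (simp add: simply_connected_eq_homotopic_paths closed_segment_subset assms(1))
  then show ?thesis
    using W_homotopic homotopic_paths_subset assms(2) by blast
qed

lemma L_triangle:
  assumes "convex S" "S \<subseteq> coll_free" "P \<in> S" "Q \<in> S" "R \<in> S"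
  shows "L P Q + L Q R = L P R"
proof -
  have seg: "closed_segment P Q \<subseteq> S" "closed_segment Q R \<subseteq> S"
    using assms by (simp_all add: closed_segment_subset)
  then have "L P Q + L Q R = W (linepath P Q +++ linepath Q R)"
    using assms by (subst W_join) auto
  also have "\<dots> = L P R"
    using W_convex[OF assms(1,2), of "linepath P Q +++ linepath Q R"] seg
    by (simp add: path_image_join)
  finally show ?thesis .
qed

lemma L_refl: "P \<in> coll_free \<Longrightarrow> L P P = 0"
  using L_triangle[of "{P}" P P P] by simp

lemma L_translate:
  assumes "closed_segment P Q \<subseteq> coll_free" "l \<in> integral_vecs" "m \<in> integral_vecs"
  shows "L (P + (l, m)) (Q + (l, m)) = L P Q"
proof -
  have "linepath (P + (l, m)) (Q + (l, m)) = (\<lambda>t. linepath P Q t + (l, m))"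
    by (rule ext) (simp add: linepath_def algebra_simps)
  then show ?thesis using W_translate[of "linepath P Q" l m] assms by simp
qed

text \<open>The value of the cocycle on the boundary of a rectangle: it is the obstruction to
  path independence among generic points.\<close>
definition rect_sum :: "real ^ 'n \<Rightarrow> real ^ 'n \<Rightarrow> real ^ 'n \<Rightarrow> real ^ 'n \<Rightarrow> real" where
  "rect_sum x x' y y' = L (x, y) (x', y) + L (x', y) (x', y') - L (x, y') (x', y') - L (x, y) (x, y')"

lemma L_horizontal: "y \<in> generic \<Longrightarrow> L (x, y) (x', y) + L (x', y) (x'', y) = L (x, y) (x'', y)"
  by (rule L_triangle[of "UNIV \<times> {y}"]) (auto simp: convex_Times generic_prod_subset(1))

lemma L_vertical: "x \<in> generic \<Longrightarrow> L (x, y) (x, y') + L (x, y') (x, y'') = L (x, y) (x, y'')"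
  by (rule L_triangle[of "{x} \<times> UNIV"]) (auto simp: convex_Times generic_prod_subset(2))

text \<open>The common vertical edge occurs with opposite signs; the horizontal edges add up because
  they lie in the collision-free slices over \<open>y\<close> and \<open>y'\<close>.\<close>

lemma rect_sum_add_x: "y \<in> generic \<Longrightarrow> y' \<in> generic \<Longrightarrow> rect_sum x x' y y' + rect_sum x' x'' y y' = rect_sum x x'' y y'"
  using L_horizontal[of y x x' x''] L_horizontal[of y' x x' x''] by (simp add: rect_sum_def)

lemma rect_sum_add_y: "x \<in> generic \<Longrightarrow> x' \<in> generic \<Longrightarrow> rect_sum x x' y y' + rect_sum x x' y' y'' = rect_sum x x' y y''"
  using L_vertical[of x y y' y''] L_vertical[of x' y y' y''] by (simp add: rect_sum_def)

lemma rect_sum_refl_x: "y \<in> generic \<Longrightarrow> y' \<in> generic \<Longrightarrow> rect_sum x x y y' = 0"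
  using rect_sum_add_x[of y y' x x x] by simp

lemma rect_sum_refl_y: "x \<in> generic \<Longrightarrow> x' \<in> generic \<Longrightarrow> rect_sum x x' y y = 0"
  using rect_sum_add_y[of x x' y y y] by simp

lemma rect_sum_swap_x: "y \<in> generic \<Longrightarrow> y' \<in> generic \<Longrightarrow> rect_sum x' x y y' = - rect_sum x x' y y'"
  using rect_sum_add_x[of y y' x x' x] rect_sum_refl_x by simp

lemma rect_sum_swap_y: "x \<in> generic \<Longrightarrow> x' \<in> generic \<Longrightarrow> rect_sum x x' y' y = - rect_sum x x' y y'"
  using rect_sum_add_y[of x x' y y' y] rect_sum_refl_y by simp

text \<open>The filled rectangle lies in a convex collision-free set, where both ways around it
  equal the diagonal.\<close>

lemma rect_sum_empty:
  assumes "closed_segment x x' \<times> closed_segment y y' \<subseteq> coll_free"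
  shows "rect_sum x x' y y' = 0"
proof -
  note tri = L_triangle[OF convex_Times[OF convex_closed_segment convex_closed_segment] assms]
  have "L (x, y) (x', y) + L (x', y) (x', y') = L (x, y) (x', y')"
    by (rule tri) auto
  moreover have "L (x, y) (x, y') + L (x, y') (x', y') = L (x, y) (x', y')"
    by (rule tri) auto
  ultimately show ?thesis by (simp add: rect_sum_def)
qed

text \<open>Opposite edges are integral translates of each other and cancel, no matter how many
  collisions the rectangle encloses.\<close>

lemma rect_sum_period:
  assumes "x \<in> generic" "y \<in> generic" "l \<in> integral_vecs" "m \<in> integral_vecs"
  shows "rect_sum x (x + l) y (y + m) = 0"
proof -
  have 0: "0 \<in> integral_vecs" by (simp add: integral_vecs_def)
  have "closed_segment (x, y) (x + l, y) \<subseteq> UNIV \<times> {y}"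
       "closed_segment (x, y) (x, y + m) \<subseteq> {x} \<times> UNIV"
    by (simp_all add: closed_segment_subset convex_Times)
  then have seg: "closed_segment (x, y) (x + l, y) \<subseteq> coll_free"
       "closed_segment (x, y) (x, y + m) \<subseteq> coll_free"
    using generic_prod_subset assms by blast+
  show ?thesis
    using L_translate[OF seg(1) 0 assms(4)] L_translate[OF seg(2) assms(3) 0] by (simp add: rect_sum_def)
qed

text \<open>The strings \<^term>\<open>i\<close> and \<^term>\<open>j\<close> move in circles and meet exactly once over a full
  period, so a single meeting contributes nothing.\<close>
lemma rect_sum_single:
  assumes "i \<noteq> j"
    and x: "upd x i u \<in> generic" "upd x i u' \<in> generic"
    and y: "upd y j v \<in> generic" "upd y j v' \<in> generic"
  shows "rect_sum (upd x i u) (upd x i u') (upd y j v) (upd y j v') = 0"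
proof -
  define T where "T u u' v v' = rect_sum (upd x i u) (upd x i u') (upd y j v) (upd y j v')" for u u' v v'
  define D where "D = {u. upd x i u \<in> generic}"
  define E where "E = {v. upd y j v \<in> generic}"
  have Dx: "u - x $ k \<notin> \<int>" if "u \<in> D" "k \<noteq> i" for u k
    using that genericD[of "upd x i u" i k] by (auto simp: D_def)
  have Ey: "v - y $ k \<notin> \<int>" if "v \<in> E" "k \<noteq> j" for v k
    using that genericD[of "upd y j v" j k] by (auto simp: E_def)
  have xx: "x $ k - x $ l \<notin> \<int>" if "k \<noteq> l" "k \<noteq> i" "l \<noteq> i" for k l
    using that genericD[OF x(1), of k l] by simp
  have yy: "y $ k - y $ l \<notin> \<int>" if "k \<noteq> l" "k \<noteq> j" "l \<noteq> j" for k l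
    using that genericD[OF y(1), of k l] by simp
  have axis: "axis k 1 \<in> integral_vecs" for k :: 'n
    by (simp add: integral_vecs_def axis_def)
  have upd1: "upd z k (w + 1) = upd z k w + axis k 1" for z :: "real ^ 'n" and k w
    by (simp add: vec_eq_iff axis_def)
  have D1: "u + 1 \<in> D" if "u \<in> D" for u
    using that by (simp add: D_def upd1 generic_add_integral axis)
  have E1: "v + 1 \<in> E" if "v \<in> E" for v
    using that by (simp add: E_def upd1 generic_add_integral axis)
  \<comment> \<open>Pairs without \<open>i\<close> stay apart in the first coordinates and pairs
    without \<open>j\<close> in the second. Only the pair of \<open>i\<close> and \<open>j\<close>
    can collide, and this requires the moving first coordinate to meet \<open>x $ j\<close> and the
    moving second coordinate to meet \<open>y $ i\<close>, both modulo 1.\<close>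
  have empty: "T u u' v v' = 0"
    if in_DE: "u \<in> D" "u' \<in> D" "v \<in> E" "v' \<in> E"
      and miss: "(\<forall>w\<in>closed_segment u u'. w - x $ j \<notin> \<int>) \<or> (\<forall>w\<in>closed_segment v v'. w - y $ i \<notin> \<int>)"
    for u u' v v'
    unfolding T_def
  proof (rule rect_sum_empty, clarify)
    fix a b assume a: "a \<in> closed_segment (upd x i u) (upd x i u')"
      and b: "b \<in> closed_segment (upd y j v) (upd y j v')"
    obtain s where s: "s \<in> closed_segment u u'" "a = upd x i s" using closed_segment_upd[OF a] .
    obtain t where t: "t \<in> closed_segment v v'" "b = upd y j t" using closed_segment_upd[OF b] .
    have key: "s - x $ j \<notin> \<int> \<or> y $ i - t \<notin> \<int>"
      using miss s t Ints_minus_commute[of t] by blast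
    have "a $ k - a $ l \<notin> \<int> \<or> b $ k - b $ l \<notin> \<int>" if "k \<noteq> l" for k l
    proof -
      consider "k \<noteq> i" "l \<noteq> i" | "k \<noteq> j" "l \<noteq> j" | "k = i" "l = j" | "k = j" "l = i"
        using that \<open>i \<noteq> j\<close> by blast
      then show ?thesis
      proof cases
        case 1
        then show ?thesis using xx[OF that] s by simp
      next
        case 2
        then show ?thesis using yy[OF that] t by simp
      next
        case 3
        then show ?thesis using key s t \<open>i \<noteq> j\<close> by simp
      next
        case 4
        then show ?thesis using key s t \<open>i \<noteq> j\<close>
          by (simp add: Ints_minus_commute[of "x $ j"] Ints_minus_commute[of t])
      qed
    qed
    then show "(a, b) \<in> coll_free" by (auto simp: coll_free_def)
  qed
  \<comment> \<open>String \<open>i\<close> makes a full turn while \<open>j\<close> moves by any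
    amount: a full turn of \<open>j\<close> gives a period rectangle, and a move of \<open>j\<close>
    inside one cell between the translates of \<open>y $ i\<close> gives an empty one.\<close>
  have period: "T u (u + 1) v v' = 0" if "u \<in> D" "v \<in> E" "v' \<in> E" for u v v'
  proof (rule floor_period_chain[where D = E and a = "y $ i" and R = "\<lambda>v v'. T u (u + 1) v v' = 0"])
    show "v + 1 \<in> E \<and> T u (u + 1) v (v + 1) = 0" if "v \<in> E" for v
      using E1[OF that] rect_sum_period[of "upd x i u" "upd y j v" "axis i 1" "axis j 1"] that \<open>u \<in> D\<close>
      unfolding T_def upd1 D_def E_def by (simp add: axis)
    show "T u (u + 1) v v' = 0" if "v \<in> E" "v' \<in> E" "\<lfloor>v - y $ i\<rfloor> = \<lfloor>v' - y $ i\<rfloor>" for v v'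
      using notin_Ints_between[OF that(3) Ey[OF that(1) \<open>i \<noteq> j\<close>] Ey[OF that(2) \<open>i \<noteq> j\<close>]]
      by (intro empty disjI2 ballI that \<open>u \<in> D\<close> D1)
    have uD: "upd x i u \<in> generic" "upd x i (u + 1) \<in> generic"
      using D1[OF \<open>u \<in> D\<close>] \<open>u \<in> D\<close> by (simp_all add: D_def)
    show "T u (u + 1) a c = 0" if "T u (u + 1) a b = 0" "T u (u + 1) b c = 0" for a b c
      using that rect_sum_add_y[OF uD, of "upd y j a" "upd y j b" "upd y j c"] by (simp add: T_def)
    show "T u (u + 1) b a = 0" if "T u (u + 1) a b = 0" for a b
      using that rect_sum_swap_y[OF uD, of "upd y j a" "upd y j b"] by (simp add: T_def)
  qed (use that in auto)
  \<comment> \<open>The same chain for the motion of \<open>i\<close>, now with the cells between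
    the translates of \<open>x $ j\<close>; the full turns have just been dealt with.\<close>
  have "\<forall>v\<in>E. \<forall>v'\<in>E. T u u' v v' = 0"
  proof (rule floor_period_chain[where D = D and a = "x $ j" and R = "\<lambda>u u'. \<forall>v\<in>E. \<forall>v'\<in>E. T u u' v v' = 0"])
    show "\<forall>v\<in>E. \<forall>v'\<in>E. T u u' v v' = 0" if "u \<in> D" "u' \<in> D" "\<lfloor>u - x $ j\<rfloor> = \<lfloor>u' - x $ j\<rfloor>" for u u'
      using notin_Ints_between[OF that(3) Dx[OF that(1)] Dx[OF that(2)]] \<open>i \<noteq> j\<close>
      by (intro ballI empty disjI1 that) auto
    show "\<forall>v\<in>E. \<forall>v'\<in>E. T a c v v' = 0"
      if ab: "\<forall>v\<in>E. \<forall>v'\<in>E. T a b v v' = 0" and bc: "\<forall>v\<in>E. \<forall>v'\<in>E. T b c v v' = 0" for a b c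
    proof (intro ballI)
      fix v v' assume v: "v \<in> E" "v' \<in> E"
      then show "T a c v v' = 0"
        using ab bc rect_sum_add_x[of "upd y j v" "upd y j v'" "upd x i a" "upd x i b" "upd x i c"]
        by (simp add: T_def E_def)
    qed
    show "\<forall>v\<in>E. \<forall>v'\<in>E. T b a v v' = 0"
      if ab: "\<forall>v\<in>E. \<forall>v'\<in>E. T a b v v' = 0" for a b
    proof (intro ballI)
      fix v v' assume v: "v \<in> E" "v' \<in> E"
      then show "T b a v v' = 0"
        using ab rect_sum_swap_x[of "upd y j v" "upd y j v'" "upd x i b" "upd x i a"]
        by (simp add: T_def E_def)
    qed
  qed (use x period D1 in \<open>auto simp: D_def\<close>)
  then show ?thesis using y by (simp add: T_def E_def)
qed

text \<open>Moving all strings in parallel produces no meetings.\<close>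
lemma rect_sum_const_y:
  assumes "y \<in> generic" shows "rect_sum x x' y (\<chi> k. y $ k + c) = 0"
  by (rule rect_sum_empty)
     (use generic_segment_add_const[OF assms] generic_prod_subset(1) in \<open>fast\<close>)

lemma rect_sum_single_x:
  assumes x: "x \<in> generic" "upd x i u \<in> generic" and y: "y \<in> generic" "y' \<in> generic"
  shows "rect_sum x (upd x i u) y y' = 0"
proof -
  \<comment> \<open>The shift is chosen so that \<open>z $ i = y' $ i\<close>; the correction from
    \<open>z\<close> to \<open>y'\<close> then leaves string \<open>i\<close> at rest.\<close>
  define z where "z = (\<chi> k. y $ k + (y' $ i - y $ i))"
  have z: "z \<in> generic" using y by (simp add: z_def generic_add_const)
  have "rect_sum x (upd x i u) y z = 0"
    unfolding z_def using y by (intro rect_sum_const_y)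
  moreover have "rect_sum x (upd x i u) z y' = 0"
  proof (rule generic_chain[where A = "- {i}" and Q = "\<lambda>z y'. rect_sum x (upd x i u) z y' = 0", OF z y(2)])
    show "rect_sum x (upd x i u) w (upd w j v) = 0"
      if "w \<in> generic" "j \<in> - {i}" "upd w j v \<in> generic" for w j v
      using rect_sum_single[of i j x "x $ i" u w "w $ j" v] that x by simp
    show "rect_sum x (upd x i u) a c = 0" if "rect_sum x (upd x i u) a b = 0" "rect_sum x (upd x i u) b c = 0" for a b c
      using that rect_sum_add_y[OF x, of a b c] by simp
  qed (use x in \<open>auto simp: z_def rect_sum_refl_y\<close>)
  ultimately show ?thesis using rect_sum_add_y[OF x, of y z y'] by simp
qed

lemma rect_sum_zero:
  assumes x: "x \<in> generic" "x' \<in> generic" and y: "y \<in> generic" "y' \<in> generic"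
  shows "rect_sum x x' y y' = 0"
proof (rule generic_chain[where A = UNIV and Q = "\<lambda>x x'. rect_sum x x' y y' = 0", OF x])
  show "rect_sum a c y y' = 0" if "rect_sum a b y y' = 0" "rect_sum b c y y' = 0" for a b c
    using that rect_sum_add_x[OF y, of a b c] by simp
qed (use y in \<open>auto simp: rect_sum_refl_x rect_sum_single_x\<close>)

end

section \<open>The integer lattice and the topology of the collision-free set\<close>

lemma integral_vecs_add: "l \<in> integral_vecs \<Longrightarrow> m \<in> integral_vecs \<Longrightarrow> l + m \<in> integral_vecs"
  by (simp add: integral_vecs_def)

lemma integral_vecs_axis: "r \<in> \<int> \<Longrightarrow> axis i r \<in> integral_vecs"
  by (simp add: integral_vecs_def axis_def)

lemma zero_integral_vecs: "0 \<in> integral_vecs"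
  by (simp add: integral_vecs_def)

lemma additive_on_integral_vecs:
  fixes k :: "real ^ 'n::finite \<Rightarrow> real"
  assumes add: "\<And>l m. l \<in> integral_vecs \<Longrightarrow> m \<in> integral_vecs \<Longrightarrow> k (l + m) = k l + k m"
    and l: "l \<in> integral_vecs"
  shows "k l = (\<Sum>i\<in>UNIV. l $ i * k (axis i 1))"
proof -
  have k0: "k 0 = 0" using add[of 0 0] by (simp add: zero_integral_vecs)
  have axis_add: "axis i (r + s) = axis i r + axis i s" for i :: 'n and r s :: real
    by (simp add: vec_eq_iff axis_def)
  have nat: "k (axis i (of_nat n)) = of_nat n * k (axis i 1)" for i :: 'n and n
  proof (induction n)
    case 0
    then show ?case using k0 by (simp add: axis_def zero_vec_def[symmetric])
  next
    case (Suc n)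
    then show ?case
      using add[of "axis i 1" "axis i (of_nat n)"]
      by (simp add: axis_add integral_vecs_axis algebra_simps)
  qed
  have axis: "k (axis i r) = r * k (axis i 1)" if r: "r \<in> \<int>" for i :: 'n and r
  proof -
    obtain n :: nat where n: "r = of_nat n \<or> r = - of_nat n"
      using r by (metis Ints_cases int_cases2 of_int_minus of_int_of_nat_eq)
    have "k (axis i (- of_nat n)) + k (axis i (of_nat n)) = 0"
      using add[of "axis i (- of_nat n)" "axis i (of_nat n)"] k0
      by (simp add: integral_vecs_axis axis_add[symmetric]) (simp add: axis_def zero_vec_def[symmetric])
    then show ?thesis using nat[of i n] n by auto
  qed
  have "(\<Sum>i\<in>A. axis i (l $ i)) \<in> integral_vecs \<and>
      k (\<Sum>i\<in>A. axis i (l $ i)) = (\<Sum>i\<in>A. l $ i * k (axis i 1))" for A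
    using finite[of A]
  proof (induction A)
    case empty
    then show ?case by (simp add: k0 zero_integral_vecs)
  next
    case (insert i A)
    have "l $ i \<in> \<int>" using l by (simp add: integral_vecs_def)
    then show ?case
      using insert axis[of "l $ i" i] by (simp add: add integral_vecs_axis integral_vecs_add)
  qed
  moreover have "l = (\<Sum>i\<in>UNIV. axis i (l $ i))"
    by (simp add: vec_eq_iff axis_def sum.delta' cong: if_cong)
  ultimately show ?thesis by metis
qed

lemma open_coll_free: "open (coll_free :: ((real ^ 'n::finite) \<times> (real ^ 'n)) set)"
proof -
  have "closed {P :: (real ^ 'n) \<times> (real ^ 'n). fst P $ i - fst P $ j \<in> \<int> \<and> snd P $ i - snd P $ j \<in> \<int>}" for i j
  proof -
    have "closed ((\<lambda>P :: (real ^ 'n) \<times> (real ^ 'n). fst P $ i - fst P $ j) -` \<int> \<inter>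
        (\<lambda>P. snd P $ i - snd P $ j) -` \<int>)"
      by (intro closed_Int closed_vimage closed_Ints continuous_intros)
    then show ?thesis by (simp add: vimage_def Collect_conj_eq[symmetric])
  qed
  then have "open (\<Inter>i. \<Inter>j\<in>-{i}. - {P :: (real ^ 'n) \<times> (real ^ 'n).
      fst P $ i - fst P $ j \<in> \<int> \<and> snd P $ i - snd P $ j \<in> \<int>})"
    by (intro open_INT ballI finite open_Compl)
  also have "(\<Inter>i. \<Inter>j\<in>-{i}. - {P :: (real ^ 'n) \<times> (real ^ 'n).
      fst P $ i - fst P $ j \<in> \<int> \<and> snd P $ i - snd P $ j \<in> \<int>}) = coll_free"
    by (auto simp: coll_free_def)
  finally show ?thesis .
qed

text \<open>A product of balls is used instead of a ball because it contains with
  \<open>(x0, y0)\<close> and \<open>(x, y)\<close> also the corner \<open>(x, y0)\<close> of the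
  route that first moves horizontally and then vertically.\<close>

definition box_nhd :: "(real ^ 'n::finite) \<times> (real ^ 'n) \<Rightarrow> real \<Rightarrow> ((real ^ 'n) \<times> (real ^ 'n)) set" where
  "box_nhd P e = ball (fst P) e \<times> ball (snd P) e"

lemma box_nhd_props: "convex (box_nhd P e)" "open (box_nhd P e)" "e > 0 \<Longrightarrow> P \<in> box_nhd P e"
  by (auto simp: box_nhd_def convex_Times open_Times mem_Times_iff)

lemma box_nhd_subset:
  assumes "open S" "P \<in> S" obtains e where "e > 0" "box_nhd P e \<subseteq> S"
proof -
  obtain A B where AB: "open A" "open B" "P \<in> A \<times> B" "A \<times> B \<subseteq> S"
    using assms by (metis open_prod_elim)
  obtain e1 where "e1 > 0" "ball (fst P) e1 \<subseteq> A"
    using AB open_contains_ball by (metis mem_Times_iff)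
  moreover obtain e2 where "e2 > 0" "ball (snd P) e2 \<subseteq> B"
    using AB open_contains_ball by (metis mem_Times_iff)
  moreover have "ball (fst P) (min e1 e2) \<subseteq> ball (fst P) e1" "ball (snd P) (min e1 e2) \<subseteq> ball (snd P) e2"
    by auto
  ultimately show thesis
    using that[of "min e1 e2"] AB(4) unfolding box_nhd_def by fastforce
qed

lemma generic_pair_dense:
  fixes P :: "(real ^ 'n::finite) \<times> (real ^ 'n)"
  assumes "open S" "P \<in> S"
  obtains x y where "x \<in> generic" "y \<in> generic" "(x, y) \<in> S"
proof -
  obtain e where e: "e > 0" "box_nhd P e \<subseteq> S" using box_nhd_subset assms .
  obtain x where "x \<in> generic" "dist x (fst P) < e" using generic_dense[OF e(1)] .
  moreover obtain y where "y \<in> generic" "dist y (snd P) < e" using generic_dense[OF e(1)] .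
  ultimately show thesis using that[of x y] e(2) by (auto simp: box_nhd_def dist_commute subset_iff)
qed

text \<open>Every point is first perturbed to a generic pair inside a convex neighbourhood. From
  there a horizontal move at generic height \<open>y\<close> and a vertical move over the generic
  \<open>x0\<close> lead to a fixed point.\<close>

lemma path_connected_coll_free: "path_connected (coll_free :: ((real ^ 'n::finite) \<times> (real ^ 'n)) set)"
proof -
  obtain x0 :: "real ^ 'n" where x0: "x0 \<in> generic" using generic_nonempty .
  have "path_component coll_free P (x0, x0)" if P: "P \<in> coll_free" for P :: "(real ^ 'n) \<times> (real ^ 'n)"
  proof -
    obtain e where e: "e > 0" "box_nhd P e \<subseteq> coll_free" using box_nhd_subset[OF open_coll_free P] .
    obtain x y where xy: "x \<in> generic" "y \<in> generic" "(x, y) \<in> box_nhd P e"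
      using generic_pair_dense[OF box_nhd_props(2) box_nhd_props(3)[OF e(1)]] .
    have 1: "path_component coll_free P (x, y)"
      using closed_segment_subset[OF box_nhd_props(3)[OF e(1)] xy(3) box_nhd_props(1)] e(2)
      by (intro path_component_linepath) auto
    have 2: "path_component coll_free (x, y) (x0, y)"
      using closed_segment_subset[of "(x, y)" "UNIV \<times> {y}" "(x0, y)"] generic_prod_subset(1)[OF xy(2)]
      by (intro path_component_linepath) (auto simp: convex_Times)
    have 3: "path_component coll_free (x0, y) (x0, x0)"
      using closed_segment_subset[of "(x0, y)" "{x0} \<times> UNIV" "(x0, x0)"] generic_prod_subset(2)[OF x0]
      by (intro path_component_linepath) (auto simp: convex_Times)
    show ?thesis by (rule path_component_trans[OF 1 path_component_trans[OF 2 3]])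
  qed
  then show ?thesis
    unfolding path_connected_component by (blast intro: path_component_sym path_component_trans)
qed

section \<open>From vanishing rectangles to a potential and its periods\<close>

context cocycle
begin

lemma ex_generic_potential:
  obtains f where "\<And>x x' y. x \<in> generic \<Longrightarrow> x' \<in> generic \<Longrightarrow> y \<in> generic \<Longrightarrow>
      L (x, y) (x', y) = f (x', y) - f (x, y)"
    and "\<And>x y y'. x \<in> generic \<Longrightarrow> y \<in> generic \<Longrightarrow> y' \<in> generic \<Longrightarrow>
      L (x, y) (x, y') = f (x, y') - f (x, y)"
proof -
  obtain x0 :: "real ^ 'n" where x0: "x0 \<in> generic" using generic_nonempty .
  \<comment> \<open>The integral along a horizontal edge at height \<open>x0\<close> and then a
    vertical edge. Its vertical increments are immediate; the horizontal ones are correct because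
    the rectangle down to height \<open>x0\<close> has sum zero.\<close>
  define f where "f = (\<lambda>(x, y). L (x0, x0) (x, x0) + L (x, x0) (x, y))"
  show thesis
  proof (rule that[of f])
    show "L (x, y) (x', y) = f (x', y) - f (x, y)"
      if "x \<in> generic" "x' \<in> generic" "y \<in> generic" for x x' y
      using rect_sum_zero[OF that(1,2) x0 that(3)] L_horizontal[OF x0, of x0 x x'] by (simp add: f_def rect_sum_def)
    show "L (x, y) (x, y') = f (x, y') - f (x, y)"
      if "x \<in> generic" "y \<in> generic" "y' \<in> generic" for x y y'
      using L_vertical[OF that(1), of x0 y y'] by (simp add: f_def)
  qed
qed

text \<open>Non-generic points have no horizontal and vertical route at their disposal, so their
  value is read off from generic neighbours: \<open>F P\<close> is the constant by which
  \<open>f Q\<close> exceeds \<open>L P Q\<close> for all generic \<open>Q\<close> near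
  \<open>P\<close>.\<close>

lemma ex_local_potential:
  obtains F where "\<And>P. P \<in> coll_free \<Longrightarrow>
    \<exists>e>0. box_nhd P e \<subseteq> coll_free \<and> (\<forall>P'\<in>box_nhd P e. L P P' = F P' - F P)"
proof -
  obtain f where fh: "\<And>x x' y. x \<in> generic \<Longrightarrow> x' \<in> generic \<Longrightarrow> y \<in> generic \<Longrightarrow>
      L (x, y) (x', y) = f (x', y) - f (x, y)"
    and fv: "\<And>x y y'. x \<in> generic \<Longrightarrow> y \<in> generic \<Longrightarrow> y' \<in> generic \<Longrightarrow>
      L (x, y) (x, y') = f (x, y') - f (x, y)"
    using ex_generic_potential by blast
  let ?nice = "\<lambda>P r. \<exists>e>0. box_nhd P e \<subseteq> coll_free \<and>
      (\<forall>Q\<in>box_nhd P e \<inter> generic \<times> generic. L P Q = f Q - r)"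
  define F where "F P = (SOME r. ?nice P r)" for P
  have F: "?nice P (F P)" if P: "P \<in> coll_free" for P
  proof -
    obtain e where e: "e > 0" "box_nhd P e \<subseteq> coll_free" using box_nhd_subset[OF open_coll_free P] .
    note tri = L_triangle[OF box_nhd_props(1) e(2)]
    obtain x0 y0 where Q0: "x0 \<in> generic" "y0 \<in> generic" "(x0, y0) \<in> box_nhd P e"
      using generic_pair_dense[OF box_nhd_props(2) box_nhd_props(3)[OF e(1)]] .
    have "L P (x, y) = f (x, y) - (f (x0, y0) - L P (x0, y0))"
      if xy: "(x, y) \<in> box_nhd P e" "x \<in> generic" "y \<in> generic" for x y
    proof -
      have corner: "(x, y0) \<in> box_nhd P e" using Q0 xy by (simp add: box_nhd_def)
      have "L P (x, y) = L P (x0, y0) + L (x0, y0) (x, y)"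
        using tri[of P "(x0, y0)" "(x, y)"] box_nhd_props(3)[OF e(1), of P] Q0 xy by simp
      also have "L (x0, y0) (x, y) = L (x0, y0) (x, y0) + L (x, y0) (x, y)"
        using tri[of "(x0, y0)" "(x, y0)" "(x, y)"] corner Q0 xy by simp
      also have "\<dots> = f (x, y) - f (x0, y0)"
        using fh[of x0 x y0] fv[of x y0 y] Q0 xy by simp
      finally show ?thesis by simp
    qed
    then have "?nice P (f (x0, y0) - L P (x0, y0))"
      using e by (intro exI[of _ e]) auto
    then show ?thesis unfolding F_def by (rule someI)
  qed
  have "\<exists>e>0. box_nhd P e \<subseteq> coll_free \<and> (\<forall>P'\<in>box_nhd P e. L P P' = F P' - F P)"
    if P: "P \<in> coll_free" for P
  proof -
    obtain e where e: "e > 0" "box_nhd P e \<subseteq> coll_free"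
      and eF: "\<And>Q. Q \<in> box_nhd P e \<Longrightarrow> Q \<in> generic \<times> generic \<Longrightarrow> L P Q = f Q - F P"
      using F[OF P] by blast
    have "L P P' = F P' - F P" if P': "P' \<in> box_nhd P e" for P'
    proof -
      obtain e' where e': "e' > 0"
        and eF': "\<And>Q. Q \<in> box_nhd P' e' \<Longrightarrow> Q \<in> generic \<times> generic \<Longrightarrow> L P' Q = f Q - F P'"
        using F[of P'] P' e by blast
      \<comment> \<open>A generic point in both neighbourhoods serves as a common reference for
        \<open>F P\<close> and \<open>F P'\<close>; its own value \<open>f (x, y)\<close>
        cancels.\<close>
      obtain x y where Q: "x \<in> generic" "y \<in> generic" "(x, y) \<in> box_nhd P e \<inter> box_nhd P' e'"
        using generic_pair_dense[of "box_nhd P e \<inter> box_nhd P' e'" P'] P' box_nhd_props e' by blast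
      have "L P P' + L P' (x, y) = L P (x, y)"
        using L_triangle[OF box_nhd_props(1) e(2)] box_nhd_props(3)[OF e(1)] P' Q by blast
      then show ?thesis using eF[of "(x, y)"] eF'[of "(x, y)"] Q by simp
    qed
    then show ?thesis using e by blast
  qed
  then show thesis using that by blast
qed

lemma ex_potential:
  obtains F where "\<And>g. path g \<Longrightarrow> path_image g \<subseteq> coll_free \<Longrightarrow> W g = F (pathfinish g) - F (pathstart g)"
proof -
  obtain F where F: "\<And>P. P \<in> coll_free \<Longrightarrow>
    \<exists>e>0. box_nhd P e \<subseteq> coll_free \<and> (\<forall>P'\<in>box_nhd P e. L P P' = F P' - F P)"
    using ex_local_potential by blast
  have "W g = F (pathfinish g) - F (pathstart g)" if g: "path g" "path_image g \<subseteq> coll_free" for g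
  proof -
    have gC: "g t \<in> coll_free" if "t \<in> {0..1}" for t using g(2) that by (auto simp: path_image_def)
    \<comment> \<open>The potential is only known to integrate short segments. Near each parameter
      the path stays in a convex collision-free box, where the cocycle along it equals that of the
      segment, so the discrepancy is locally constant.\<close>
    have "(\<lambda>t. W (subpath 0 t g) - F (g t)) constant_on {0..1::real}"
    proof (rule locally_constant_imp_constant)
      fix a :: real assume a: "a \<in> {0..1}"
      obtain e where e: "e > 0" "box_nhd (g a) e \<subseteq> coll_free"
        and eF: "\<And>P'. P' \<in> box_nhd (g a) e \<Longrightarrow> L (g a) P' = F P' - F (g a)"
        using F[OF gC[OF a]] by blast
      have cont: "continuous_on {0..1} g" using g by (simp add: path_def)
      have "\<exists>A. open A \<and> a \<in> A \<and> (\<forall>t\<in>{0..1}. t \<in> A \<longrightarrow> g t \<in> box_nhd (g a) e)"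
        using cont a box_nhd_props(2)[of "g a" e] box_nhd_props(3)[OF e(1), of "g a"]
        by (simp add: continuous_on_topological)
      then obtain A where A: "open A" "a \<in> A" "\<And>t. t \<in> {0..1} \<Longrightarrow> t \<in> A \<Longrightarrow> g t \<in> box_nhd (g a) e"
        by blast
      obtain d where d: "d > 0" "ball a d \<subseteq> A" using A open_contains_ball by blast
      show "\<exists>T. openin (top_of_set {0..1}) T \<and> a \<in> T \<and>
          (\<forall>t\<in>T. W (subpath 0 t g) - F (g t) = W (subpath 0 a g) - F (g a))"
      proof (intro exI[of _ "{0..1} \<inter> ball a d"] conjI ballI)
        fix t assume t: "t \<in> {0..1} \<inter> ball a d"
        have seg: "closed_segment a t \<subseteq> {0..1} \<inter> ball a d"
          using a t d by (intro closed_segment_subset convex_Int) auto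
        have img: "path_image (subpath a t g) \<subseteq> box_nhd (g a) e"
          unfolding path_image_subpath_gen using seg d(2) A(3) by blast
        have "W (subpath a t g) = L (g a) (g t)"
          using W_convex[OF box_nhd_props(1) e(2) _ img] g a t by simp
        also have "\<dots> = F (g t) - F (g a)"
          using eF[of "g t"] A(3)[of t] t d by auto
        finally have "W (subpath a t g) = F (g t) - F (g a)" .
        moreover have "W (subpath 0 t g) = W (subpath 0 a g +++ subpath a t g)"
          using W_homotopic[OF homotopic_join_subpaths[OF g, of 0 a t]] a t by simp
        moreover have "\<dots> = W (subpath 0 a g) + W (subpath a t g)"
          using g a t path_image_subpath_subset[of 0 a g] path_image_subpath_subset[of a t g]
          by (intro W_join) auto
        ultimately show "W (subpath 0 t g) - F (g t) = W (subpath 0 a g) - F (g a)" by simp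
      qed (use a d in \<open>auto simp: openin_open_Int\<close>)
    qed auto
    then have "W (subpath 0 1 g) - F (g 1) = W (subpath 0 0 g) - F (g 0)"
      unfolding constant_on_def by (metis atLeastAtMost_iff order_refl zero_le_one)
    moreover have "W (subpath 0 0 g) = 0"
      using W_convex[of "{g 0}" "subpath 0 0 g"] gC[of 0] g L_refl
      by (auto simp: path_image_subpath_gen)
    ultimately show ?thesis by (simp add: pathfinish_def pathstart_def)
  qed
  then show thesis using that by blast
qed

text \<open>A path from \<open>P0\<close> to \<open>P\<close> and its lattice translate have the
  same value, so the increment of the potential under a lattice vector is the same at
  \<open>P0\<close> and at \<open>P\<close>. Hence it is additive in the lattice vector, and the
  coefficients are the increments for the unit vectors.\<close>

theorem W_periods:
  "\<exists>\<alpha> \<beta> :: 'n \<Rightarrow> real. \<forall>g l m. path g \<longrightarrow> path_image g \<subseteq> coll_free \<longrightarrow>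
     l \<in> integral_vecs \<longrightarrow> m \<in> integral_vecs \<longrightarrow> pathfinish g = pathstart g + (l, m) \<longrightarrow>
     W g = (\<Sum>i\<in>UNIV. l $ i * \<alpha> i) + (\<Sum>i\<in>UNIV. m $ i * \<beta> i)"
proof -
  obtain F where F: "\<And>g. path g \<Longrightarrow> path_image g \<subseteq> coll_free \<Longrightarrow> W g = F (pathfinish g) - F (pathstart g)"
    using ex_potential by blast
  obtain x0 :: "real ^ 'n" where "x0 \<in> generic" using generic_nonempty .
  then have P0: "(x0, x0) \<in> coll_free" using generic_prod_subset by blast
  define P0 where "P0 = (x0, x0)"
  define k where "k \<Lambda> = F (P0 + \<Lambda>) - F P0" for \<Lambda>
  have shift: "F (P + (l, m)) - F P = k (l, m)"
    if P: "P \<in> coll_free" and lm: "l \<in> integral_vecs" "m \<in> integral_vecs" for P l m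
  proof -
    obtain h where h: "path h" "path_image h \<subseteq> coll_free" "pathstart h = P0" "pathfinish h = P"
      using path_connected_coll_free P P0 unfolding path_connected_def P0_def by blast
    let ?h = "\<lambda>t. h t + (l, m)"
    have "path ?h" using h(1) unfolding path_def by (intro continuous_intros)
    moreover have "path_image ?h \<subseteq> coll_free"
      using h(2) by (simp add: path_image_def image_subset_iff coll_free_translate[OF lm])
    ultimately have "W ?h = F (P + (l, m)) - F (P0 + (l, m))"
      using F[of ?h] h by (simp add: pathstart_def pathfinish_def)
    then show ?thesis
      using W_translate[OF h(1,2) lm] F[OF h(1,2)] h by (simp add: k_def)
  qed
  have P0l: "P0 + (l, m) \<in> coll_free" if "l \<in> integral_vecs" "m \<in> integral_vecs" for l m
    using coll_free_translate[OF that, of P0] P0 by (simp add: P0_def del: add_Pair)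
  have k_add: "k (l + l', m + m') = k (l, m) + k (l', m')"
    if "l \<in> integral_vecs" "m \<in> integral_vecs" "l' \<in> integral_vecs" "m' \<in> integral_vecs" for l m l' m'
    using shift[OF P0l[OF that(1,2)] that(3,4)] by (simp add: k_def add_ac)
  have k: "k (l, m) = (\<Sum>i\<in>UNIV. l $ i * k (axis i 1, 0)) + (\<Sum>i\<in>UNIV. m $ i * k (0, axis i 1))"
    if lm: "l \<in> integral_vecs" "m \<in> integral_vecs" for l m
  proof -
    have "k (l, 0) = (\<Sum>i\<in>UNIV. l $ i * k (axis i 1, 0))"
      by (rule additive_on_integral_vecs[OF _ lm(1), of "\<lambda>l. k (l, 0)"])
         (use k_add[where m = 0 and m' = 0] zero_integral_vecs in auto)
    moreover have "k (0, m) = (\<Sum>i\<in>UNIV. m $ i * k (0, axis i 1))"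
      by (rule additive_on_integral_vecs[OF _ lm(2), of "\<lambda>m. k (0, m)"])
         (use k_add[where l = 0 and l' = 0] zero_integral_vecs in auto)
    ultimately show ?thesis
      using k_add[of l 0 0 m] lm zero_integral_vecs by simp
  qed
  show ?thesis
  proof (intro exI allI impI)
    fix g :: "real \<Rightarrow> (real ^ 'n) \<times> (real ^ 'n)" and l m
    assume g: "path g" "path_image g \<subseteq> coll_free" and lm: "l \<in> integral_vecs" "m \<in> integral_vecs"
      and fin: "pathfinish g = pathstart g + (l, m)"
    have "pathstart g \<in> coll_free" using g(2) by blast
    then show "W g = (\<Sum>i\<in>UNIV. l $ i * k (axis i 1, 0)) + (\<Sum>i\<in>UNIV. m $ i * k (0, axis i 1))"
      using F[OF g] fin shift lm k by simp
  qed
qed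

end

section \<open>Fundamental groups\<close>

lemma based_loopsD:
  assumes "g \<in> based_loops S p"
  shows "path g" "path_image g \<subseteq> S" "pathstart g = p" "pathfinish g = p"
  using assms by (auto simp: based_loops_def)

lemma based_loops_join: "f \<in> based_loops S p \<Longrightarrow> g \<in> based_loops S p \<Longrightarrow> f +++ g \<in> based_loops S p"
  by (auto simp: based_loops_def path_image_join)

lemma based_loops_reversepath: "f \<in> based_loops S p \<Longrightarrow> reversepath f \<in> based_loops S p"
  by (auto simp: based_loops_def)

lemma based_loops_linepath: "p \<in> S \<Longrightarrow> linepath p p \<in> based_loops S p"
  by (auto simp: based_loops_def)

lemma loop_class_eq_iff:
  assumes "path g" "path_image g \<subseteq> S"
  shows "loop_class S g = loop_class S h \<longleftrightarrow> homotopic_paths S g h"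
proof
  assume "loop_class S g = loop_class S h"
  moreover have "g \<in> loop_class S g" using assms by (simp add: loop_class_def)
  ultimately show "homotopic_paths S g h"
    by (simp add: loop_class_def homotopic_paths_sym)
qed (use homotopic_paths_sym homotopic_paths_trans in \<open>unfold loop_class_def, blast\<close>)

lemma loop_class_cong: "homotopic_paths S g h \<Longrightarrow> loop_class S g = loop_class S h"
  by (simp add: homotopic_paths_imp_path homotopic_paths_imp_subset loop_class_eq_iff)

lemma carrier_fundamental_group: "carrier (fundamental_group S p) = loop_class S ` based_loops S p"
  by (simp add: fundamental_group_def)

lemma loop_class_in_carrier: "f \<in> based_loops S p \<Longrightarrow> loop_class S f \<in> carrier (fundamental_group S p)"
  by (simp add: carrier_fundamental_group)

lemma one_fundamental_group: "\<one>\<^bsub>fundamental_group S p\<^esub> = loop_class S (linepath p p)"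
  by (simp add: fundamental_group_def linepath_refl)

lemma mult_fundamental_group:
  assumes f: "f \<in> based_loops S p" and g: "g \<in> based_loops S p"
  shows "loop_class S f \<otimes>\<^bsub>fundamental_group S p\<^esub> loop_class S g = loop_class S (f +++ g)"
proof -
  have "homotopic_paths S (f +++ g) h"
    if "homotopic_paths S f f'" "homotopic_paths S g g'" "homotopic_paths S (f' +++ g') h" for f' g' h
    using homotopic_paths_trans[OF homotopic_paths_join[OF that(1,2)] that(3)]
      based_loopsD[OF f] based_loopsD[OF g] by simp
  moreover have "homotopic_paths S f f" "homotopic_paths S g g"
    using based_loopsD[OF f] based_loopsD[OF g] by auto
  ultimately have "(\<exists>f'. homotopic_paths S f f' \<and> (\<exists>g'. homotopic_paths S g g' \<and>
      homotopic_paths S (f' +++ g') h)) \<longleftrightarrow> homotopic_paths S (f +++ g) h" for h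
    by blast
  then show ?thesis
    by (simp add: fundamental_group_def loop_class_def)
qed

lemma group_fundamental_group:
  fixes S :: "'a::real_normed_vector set"
  assumes "p \<in> S" shows "group (fundamental_group S p)"
proof (rule groupI; (simp only: carrier_fundamental_group one_fundamental_group)?)
  show "loop_class S (linepath p p) \<in> loop_class S ` based_loops S p"
    using based_loops_linepath[OF assms] by blast
next
  fix x y assume "x \<in> loop_class S ` based_loops S p" "y \<in> loop_class S ` based_loops S p"
  then show "x \<otimes>\<^bsub>fundamental_group S p\<^esub> y \<in> loop_class S ` based_loops S p"
    by (auto simp: mult_fundamental_group based_loops_join)
next
  fix x y z
  assume "x \<in> loop_class S ` based_loops S p" "y \<in> loop_class S ` based_loops S p"
    "z \<in> loop_class S ` based_loops S p"
  then obtain f g h where *: "x = loop_class S f" "y = loop_class S g" "z = loop_class S h"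
    "f \<in> based_loops S p" "g \<in> based_loops S p" "h \<in> based_loops S p"
    by blast
  have "homotopic_paths S (f +++ g +++ h) ((f +++ g) +++ h)"
    by (rule homotopic_paths_assoc) (use * in \<open>simp_all add: based_loopsD\<close>)
  then show "x \<otimes>\<^bsub>fundamental_group S p\<^esub> y \<otimes>\<^bsub>fundamental_group S p\<^esub> z =
      x \<otimes>\<^bsub>fundamental_group S p\<^esub> (y \<otimes>\<^bsub>fundamental_group S p\<^esub> z)"
    using * by (simp add: mult_fundamental_group based_loops_join loop_class_cong)
next
  fix x assume "x \<in> loop_class S ` based_loops S p"
  then obtain f where f: "x = loop_class S f" "f \<in> based_loops S p" by blast
  have "homotopic_paths S (linepath p p +++ f) f"
    using based_loopsD[OF f(2)] by (intro homotopic_paths_lid') auto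
  then show "loop_class S (linepath p p) \<otimes>\<^bsub>fundamental_group S p\<^esub> x = x"
    using f assms by (simp add: mult_fundamental_group based_loops_linepath loop_class_cong)
  have "homotopic_paths S (reversepath f +++ f) (linepath p p)"
    using homotopic_paths_linv[of f S] based_loopsD[OF f(2)] by simp
  then show "\<exists>y\<in>loop_class S ` based_loops S p. y \<otimes>\<^bsub>fundamental_group S p\<^esub> x = loop_class S (linepath p p)"
    using f by (intro bexI[of _ "loop_class S (reversepath f)"])
      (auto simp: mult_fundamental_group based_loops_reversepath loop_class_cong)
qed

lemma inv_fundamental_group:
  fixes S :: "'a::real_normed_vector set"
  assumes "f \<in> based_loops S p"
  shows "inv\<^bsub>fundamental_group S p\<^esub> loop_class S f = loop_class S (reversepath f)"
proof -
  have "p \<in> S" using based_loopsD[OF assms] pathstart_in_path_image by blast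
  then interpret group "fundamental_group S p" by (rule group_fundamental_group)
  have "homotopic_paths S (reversepath f +++ f) (linepath p p)"
    using homotopic_paths_linv[of f S] based_loopsD[OF assms] by simp
  then show ?thesis
    using assms by (intro inv_equality)
      (simp_all add: mult_fundamental_group one_fundamental_group based_loops_reversepath loop_class_cong
        loop_class_in_carrier)
qed

section \<open>Cancelling a path against its reverse\<close>

lemma homotopic_paths_join_right:
  "\<lbrakk>homotopic_paths S q q'; path p; path_image p \<subseteq> S; pathfinish p = pathstart q\<rbrakk>
    \<Longrightarrow> homotopic_paths S (p +++ q) (p +++ q')"
  by (simp add: homotopic_paths_join)

lemma homotopic_paths_join_left:
  "\<lbrakk>homotopic_paths S p p'; path q; path_image q \<subseteq> S; pathfinish p = pathstart q\<rbrakk>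
    \<Longrightarrow> homotopic_paths S (p +++ q) (p' +++ q)"
  by (simp add: homotopic_paths_join)

lemma homotopic_paths_insert_inverse:
  fixes S :: "'a::real_normed_vector set"
  assumes "path a" "path_image a \<subseteq> S" "path b" "path_image b \<subseteq> S" "path c" "path_image c \<subseteq> S"
    and "pathfinish a = pathfinish c" "pathstart b = pathfinish c"
  shows "homotopic_paths S ((a +++ reversepath c) +++ (c +++ b)) (a +++ b)"
proof -
  note [trans] = homotopic_paths_trans
  let ?z = "linepath (pathfinish c) (pathfinish c)"
  have "homotopic_paths S ((a +++ reversepath c) +++ (c +++ b)) (a +++ (reversepath c +++ (c +++ b)))"
    by (rule homotopic_paths_sym, rule homotopic_paths_assoc) (use assms in \<open>auto simp: path_image_join\<close>)
  also
  have "homotopic_paths S (reversepath c +++ (c +++ b)) ((reversepath c +++ c) +++ b)"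
    by (rule homotopic_paths_assoc) (use assms in \<open>auto simp: path_image_join\<close>)
  then have "homotopic_paths S (a +++ (reversepath c +++ (c +++ b))) (a +++ ((reversepath c +++ c) +++ b))"
    by (rule homotopic_paths_join_right) (use assms in auto)
  also
  have "homotopic_paths S ((reversepath c +++ c) +++ b) (?z +++ b)"
    using assms by (intro homotopic_paths_join homotopic_paths_linv) auto
  then have "homotopic_paths S (a +++ ((reversepath c +++ c) +++ b)) (a +++ (?z +++ b))"
    by (rule homotopic_paths_join_right) (use assms in auto)
  also
  have "homotopic_paths S (?z +++ b) b"
    using assms by (intro homotopic_paths_lid') auto
  then have "homotopic_paths S (a +++ (?z +++ b)) (a +++ b)"
    by (rule homotopic_paths_join_right) (use assms in auto)
  finally show ?thesis .
qed

text \<open>The inner detour along \<open>c1\<close> is traversed back and forth and cancels.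
  Allowing three connecting paths serves two purposes: closing up open paths with varying end
  points, and conjugating loops by a single path.\<close>

lemma homotopic_conjugate_join:
  fixes S :: "'a::real_normed_vector set"
  assumes "path c0" "path_image c0 \<subseteq> S" "path c1" "path_image c1 \<subseteq> S" "path c2" "path_image c2 \<subseteq> S"
    and "path g" "path_image g \<subseteq> S" "path h" "path_image h \<subseteq> S"
    and "pathfinish c0 = pathstart g" "pathfinish g = pathfinish c1" "pathstart h = pathfinish c1"
    and "pathfinish h = pathfinish c2"
  shows "homotopic_paths S ((c0 +++ (g +++ reversepath c1)) +++ (c1 +++ (h +++ reversepath c2)))
           (c0 +++ ((g +++ h) +++ reversepath c2))"
proof -
  note [trans] = homotopic_paths_trans
  have "homotopic_paths S ((c0 +++ (g +++ reversepath c1)) +++ (c1 +++ (h +++ reversepath c2)))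
      (((c0 +++ g) +++ reversepath c1) +++ (c1 +++ (h +++ reversepath c2)))"
    by (intro homotopic_paths_join homotopic_paths_assoc) (use assms in \<open>auto simp: path_image_join\<close>)
  also
  have "homotopic_paths S (((c0 +++ g) +++ reversepath c1) +++ (c1 +++ (h +++ reversepath c2)))
      ((c0 +++ g) +++ (h +++ reversepath c2))"
    by (rule homotopic_paths_insert_inverse) (use assms in \<open>auto simp: path_image_join\<close>)
  also
  have "homotopic_paths S ((c0 +++ g) +++ (h +++ reversepath c2)) (c0 +++ (g +++ (h +++ reversepath c2)))"
    by (rule homotopic_paths_sym, rule homotopic_paths_assoc) (use assms in \<open>auto simp: path_image_join\<close>)
  also
  have "homotopic_paths S (g +++ (h +++ reversepath c2)) ((g +++ h) +++ reversepath c2)"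
    by (rule homotopic_paths_assoc) (use assms in \<open>auto simp: path_image_join\<close>)
  then have "homotopic_paths S (c0 +++ (g +++ (h +++ reversepath c2))) (c0 +++ ((g +++ h) +++ reversepath c2))"
    by (rule homotopic_paths_join_right) (use assms in auto)
  finally show ?thesis .
qed

text \<open>Every point is joined to \<open>p\<close> once and for all, and a path is evaluated on
  the loop obtained by closing it up along the chosen connections.\<close>

lemma character_extends_to_paths:
  fixes \<psi> :: "(real \<Rightarrow> 'a::real_normed_vector) set \<Rightarrow> real"
  assumes S: "path_connected S" "p \<in> S" and \<psi>: "\<psi> \<in> hom (fundamental_group S p) real_group"
  obtains \<Phi> where
    "\<And>g h. homotopic_paths S g h \<Longrightarrow> \<Phi> g = \<Phi> h"
    "\<And>g h. \<lbrakk>path g; path_image g \<subseteq> S; path h; path_image h \<subseteq> S; pathfinish g = pathstart h\<rbrakk>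
      \<Longrightarrow> \<Phi> (g +++ h) = \<Phi> g + \<Phi> h"
    "\<And>g. g \<in> based_loops S p \<Longrightarrow> \<Phi> g = \<psi> (loop_class S g)"
proof -
  have "\<forall>q\<in>S. \<exists>c. path c \<and> path_image c \<subseteq> S \<and> pathstart c = p \<and> pathfinish c = q"
    using S unfolding path_connected_def by blast
  then obtain c where c: "\<And>q. q \<in> S \<Longrightarrow> path (c q) \<and> path_image (c q) \<subseteq> S \<and> pathstart (c q) = p \<and> pathfinish (c q) = q"
    by metis
  have mult: "\<psi> (loop_class S (f +++ g)) = \<psi> (loop_class S f) + \<psi> (loop_class S g)"
    if "f \<in> based_loops S p" "g \<in> based_loops S p" for f g
    using \<psi> that by (simp add: hom_real_group_iff loop_class_in_carrier flip: mult_fundamental_group)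
  define cl where "cl g = c (pathstart g) +++ (g +++ reversepath (c (pathfinish g)))" for g
  have ends: "pathstart g \<in> S" "pathfinish g \<in> S" if "path_image g \<subseteq> S" for g
    using that by auto
  have cl: "cl g \<in> based_loops S p" if "path g" "path_image g \<subseteq> S" for g
    using that c ends[OF that(2)] by (auto simp: cl_def based_loops_def path_image_join)
  show thesis
  proof (rule that[of "\<lambda>g. \<psi> (loop_class S (cl g))"])
    fix g h assume gh: "homotopic_paths S g h"
    then have g: "path g" "path_image g \<subseteq> S"
      using homotopic_paths_imp_path homotopic_paths_imp_subset by blast+
    have "homotopic_paths S (cl g) (cl h)"
      unfolding cl_def using gh homotopic_paths_imp_pathstart[OF gh] homotopic_paths_imp_pathfinish[OF gh]
        c ends[OF g(2)] by (intro homotopic_paths_join) auto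
    then show "\<psi> (loop_class S (cl g)) = \<psi> (loop_class S (cl h))"
      by (simp add: loop_class_cong)
  next
    fix g h assume g: "path g" "path_image g \<subseteq> S" and h: "path h" "path_image h \<subseteq> S"
      and gh: "pathfinish g = pathstart h"
    have "homotopic_paths S (cl g +++ cl h) (cl (g +++ h))"
      unfolding cl_def gh pathstart_join pathfinish_join
      by (rule homotopic_conjugate_join) (use g h gh c ends[OF g(2)] ends[OF h(2)] in auto)
    then have "loop_class S (cl (g +++ h)) = loop_class S (cl g +++ cl h)"
      by (simp add: loop_class_cong homotopic_paths_sym)
    then show "\<psi> (loop_class S (cl (g +++ h))) = \<psi> (loop_class S (cl g)) + \<psi> (loop_class S (cl h))"
      using mult[OF cl[OF g] cl[OF h]] by simp
  next
    fix g assume g: "g \<in> based_loops S p"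
    \<comment> \<open>The connection chosen from \<open>p\<close> to itself may be a nontrivial
      loop. It only conjugates, and a real-valued character does not see conjugation.\<close>
    have cp: "c p \<in> based_loops S p" using c[OF S(2)] by (simp add: based_loops_def)
    have "\<psi> (loop_class S (reversepath (c p))) = - \<psi> (loop_class S (c p))"
      using character_inv[OF group_fundamental_group[OF S(2)] \<psi> loop_class_in_carrier[OF cp]]
      by (simp add: inv_fundamental_group[OF cp])
    then show "\<psi> (loop_class S (cl g)) = \<psi> (loop_class S g)"
      using mult g cp by (simp add: cl_def based_loopsD based_loops_join based_loops_reversepath)
  qed
qed

section \<open>Winding numbers of strings\<close>

definition torus_cover :: "(real ^ 'n::finite) \<times> (real ^ 'n) \<Rightarrow> (complex \<times> complex) ^ 'n" where
  "torus_cover P = (\<chi> j. (cis (2 * pi * fst P $ j), cis (2 * pi * snd P $ j)))"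

lemma cis_2pi_eq_iff: "cis (2 * pi * x) = cis (2 * pi * y) \<longleftrightarrow> x - y \<in> \<int>"
proof -
  have "cis (2 * pi * x) = cis (2 * pi * y) \<longleftrightarrow> cis (2 * pi * x) / cis (2 * pi * y) = 1"
    by simp
  also have "cis (2 * pi * x) / cis (2 * pi * y) = cis (2 * pi * (x - y))"
    by (simp add: cis_divide right_diff_distrib)
  also have "\<dots> = 1 \<longleftrightarrow> (\<exists>n::int. x - y = of_int n)"
    by (auto simp: cis_eq_1_iff)
  finally show ?thesis by (auto simp: Ints_def)
qed

lemma torus_cover_in_torus: "torus_cover P $ i \<in> torus"
  by (simp add: torus_cover_def torus_def)

lemma torus_cover_in_config_space: "torus_cover P \<in> config_space torus \<longleftrightarrow> P \<in> coll_free"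
  by (cases P) (auto simp: config_space_def torus_cover_in_torus coll_free_def, auto simp: torus_cover_def cis_2pi_eq_iff)

lemma torus_cover_translate:
  assumes "l \<in> integral_vecs" "m \<in> integral_vecs"
  shows "torus_cover (P + (l, m)) = torus_cover P"
  using assms by (auto simp: torus_cover_def vec_eq_iff cis_2pi_eq_iff integral_vecs_def)

lemma torus_cover_surj:
  assumes "q \<in> config_space torus"
  obtains P where "P \<in> coll_free" "torus_cover P = q"
proof -
  have q: "norm (fst (q $ i)) = 1" "norm (snd (q $ i)) = 1" for i
    using assms by (auto simp: config_space_def torus_def mem_Times_iff)
  have cis: "cis (2 * pi * (Arg z / (2 * pi))) = z" if "norm z = 1" for z
    using that cis_Arg[of z] by (cases "z = 0") (auto simp: sgn_div_norm)
  let ?P = "(\<chi> i. Arg (fst (q $ i)) / (2 * pi), \<chi> i. Arg (snd (q $ i)) / (2 * pi))"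
  have eq: "torus_cover ?P = q"
    using cis[OF q(1)] cis[OF q(2)] by (simp add: torus_cover_def vec_eq_iff prod_eq_iff)
  then show thesis
    using that[of ?P] assms torus_cover_in_config_space[of ?P] by simp
qed

lemma continuous_on_torus_cover: "continuous_on S torus_cover"
  unfolding torus_cover_def cis_conv_exp by (intro continuous_intros)

lemma path_connected_config_space: "path_connected (config_space torus :: ((complex \<times> complex) ^ 'n::finite) set)"
proof -
  have "q \<in> torus_cover ` coll_free" if "q \<in> config_space torus" for q :: "(complex \<times> complex) ^ 'n"
    by (rule torus_cover_surj[OF that]) blast
  then have "torus_cover ` coll_free = (config_space torus :: ((complex \<times> complex) ^ 'n) set)"
    by (auto simp: torus_cover_in_config_space)
  then show ?thesis
    using path_connected_continuous_image[OF continuous_on_torus_cover path_connected_coll_free] by metis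
qed

text \<open>For an open path the complex winding number also records a change of modulus. Its real
  part is the total change of angle in full turns, which makes sense and is additive for open paths
  too.\<close>

definition winding :: "(complex \<times> complex \<Rightarrow> complex) \<Rightarrow> (real \<Rightarrow> (complex \<times> complex) ^ 'n) \<Rightarrow> 'n \<Rightarrow> real" where
  "winding pr g i = Re (winding_number (\<lambda>t. pr (g t $ i)) 0)"

definition projs :: "(complex \<times> complex \<Rightarrow> complex) set" where
  "projs = {fst, snd}"

lemma continuous_on_proj: "pr \<in> projs \<Longrightarrow> continuous_on S (\<lambda>x. pr (x $ i))"
  unfolding projs_def by (auto intro!: continuous_intros)

lemma path_proj:
  assumes "pr \<in> projs" "path g"
  shows "path (\<lambda>t. pr (g t $ i))"
  using path_continuous_image[OF assms(2) continuous_on_proj[OF assms(1)]] by (simp add: o_def)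

lemma norm_proj: "pr \<in> projs \<Longrightarrow> x \<in> config_space torus \<Longrightarrow> norm (pr (x $ i)) = 1"
  by (auto simp: projs_def config_space_def torus_def mem_Times_iff)

lemma proj_nonzero:
  assumes "pr \<in> projs" "path_image g \<subseteq> config_space torus"
  shows "0 \<notin> path_image (\<lambda>t. pr (g t $ i))"
proof
  assume "0 \<in> path_image (\<lambda>t. pr (g t $ i))"
  then obtain t where "t \<in> {0..1}" "pr (g t $ i) = 0" by (auto simp: path_image_def)
  moreover have "g t \<in> config_space torus" using assms(2) \<open>t \<in> {0..1}\<close> by (auto simp: path_image_def)
  ultimately show False using norm_proj[OF assms(1), of "g t" i] by simp
qed

lemma winding_homotopic:
  assumes pr: "pr \<in> projs" and gh: "homotopic_paths (config_space torus) g h"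
  shows "winding pr g i = winding pr h i"
proof -
  have "homotopic_paths (- {0}) ((\<lambda>x. pr (x $ i)) \<circ> g) ((\<lambda>x. pr (x $ i)) \<circ> h)"
    by (rule homotopic_paths_continuous_image[OF gh continuous_on_proj[OF pr]])
       (use norm_proj[OF pr, of _ i] in fastforce)
  then show ?thesis
    using winding_number_homotopic_paths by (simp add: winding_def o_def)
qed

lemma winding_join:
  assumes "pr \<in> projs" "path g" "path_image g \<subseteq> config_space torus" "path h" "path_image h \<subseteq> config_space torus"
    and "pathfinish g = pathstart h"
  shows "winding pr (g +++ h) i = winding pr g i + winding pr h i"
proof -
  have "(\<lambda>t. pr ((g +++ h) t $ i)) = (\<lambda>t. pr (g t $ i)) +++ (\<lambda>t. pr (h t $ i))"
    by (auto simp: joinpaths_def)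
  then show ?thesis
    using winding_number_join[OF path_proj[OF assms(1,2), of i] proj_nonzero[OF assms(1,3), of i]
        path_proj[OF assms(1,4), of i] proj_nonzero[OF assms(1,5), of i]] assms(6)
    by (simp add: winding_def pathfinish_def pathstart_def)
qed

lemma winding_reversepath:
  assumes "pr \<in> projs" "path g" "path_image g \<subseteq> config_space torus"
  shows "winding pr (reversepath g) i = - winding pr g i"
proof -
  have "(\<lambda>t. pr (reversepath g t $ i)) = reversepath (\<lambda>t. pr (g t $ i))"
    by (auto simp: reversepath_def)
  then show ?thesis
    using winding_number_reversepath[OF path_proj[OF assms(1,2), of i] proj_nonzero[OF assms(1,3), of i]]
    by (simp add: winding_def)
qed

text \<open>A continuous logarithm of the coordinate along the path has the lifted angle as
  imaginary part; its real part contributes nothing because the coordinate has norm 1.\<close>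

lemma lift_component:
  assumes pr: "pr \<in> projs" and g: "path g" "path_image g \<subseteq> config_space torus"
  obtains x :: "real \<Rightarrow> real" where "path x" "x 1 - x 0 = winding pr g i"
    "\<And>t. t \<in> {0..1} \<Longrightarrow> pr (g t $ i) = cis (2 * pi * x t)"
proof -
  obtain q where q: "path q"
      "pathfinish q - pathstart q = 2 * of_real pi * \<i> * winding_number (\<lambda>t. pr (g t $ i)) 0"
      "\<And>t. t \<in> {0..1} \<Longrightarrow> pr (g t $ i) = 0 + exp (q t)"
    using winding_number_as_continuous_log[OF path_proj[OF pr g(1), of i] proj_nonzero[OF pr g(2), of i]]
    by metis
  show thesis
  proof (rule that[of "\<lambda>t. Im (q t) / (2 * pi)"])
    show "path (\<lambda>t. Im (q t) / (2 * pi))"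
      using q(1) unfolding path_def by (intro continuous_intros) auto
    have "Im (q 1 - q 0) = 2 * pi * winding pr g i"
      using q(2) by (simp add: pathfinish_def pathstart_def winding_def)
    then show "Im (q 1) / (2 * pi) - Im (q 0) / (2 * pi) = winding pr g i"
      by (simp add: field_simps)
    fix t :: real assume t: "t \<in> {0..1}"
    then have "g t \<in> config_space torus" using g(2) by (auto simp: path_image_def)
    then have "norm (exp (q t)) = 1" using norm_proj[OF pr] q(3)[OF t] by (metis add_0)
    then have "exp (q t) = cis (Im (q t))"
      by (simp add: exp_eq_polar norm_mult)
    then show "pr (g t $ i) = cis (2 * pi * (Im (q t) / (2 * pi)))" using q(3)[OF t] by simp
  qed
qed

text \<open>The displacement of the lift is recorded because it is the only datum of a path that
  enters \<open>W_periods\<close>.\<close>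

lemma lift_path:
  fixes g :: "real \<Rightarrow> (complex \<times> complex) ^ 'n::finite"
  assumes g: "path g" "path_image g \<subseteq> config_space torus"
  obtains h where "path h" "path_image h \<subseteq> coll_free" "\<And>t. t \<in> {0..1} \<Longrightarrow> torus_cover (h t) = g t"
    "pathfinish h = pathstart h + ((\<chi> i. winding fst g i), (\<chi> i. winding snd g i))"
proof -
  have pr: "fst \<in> projs" "snd \<in> projs" by (auto simp: projs_def)
  have ex_lift: "\<exists>x. (\<forall>i. path (x i)) \<and> (\<forall>i. x i 1 - x i 0 = winding pr g i) \<and>
      (\<forall>i. \<forall>t\<in>{0..1}. pr (g t $ i) = cis (2 * pi * x i t))" if pr: "pr \<in> projs" for pr
  proof -
    have "\<exists>x. path x \<and> x 1 - x 0 = winding pr g i \<and> (\<forall>t\<in>{0..1}. pr (g t $ i) = cis (2 * pi * x t))" for i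
      by (rule lift_component[OF pr g, of i]) blast
    then show ?thesis by metis
  qed
  obtain x where x: "\<And>i. path (x i)" "\<And>i. x i 1 - x i 0 = winding fst g i"
    "\<And>i t. t \<in> {0..1} \<Longrightarrow> fst (g t $ i) = cis (2 * pi * x i t)"
    using ex_lift[OF pr(1)] by blast
  obtain y where y: "\<And>i. path (y i)" "\<And>i. y i 1 - y i 0 = winding snd g i"
    "\<And>i t. t \<in> {0..1} \<Longrightarrow> snd (g t $ i) = cis (2 * pi * y i t)"
    using ex_lift[OF pr(2)] by blast
  define h where "h t = ((\<chi> i. x i t), (\<chi> i. y i t))" for t
  have lift: "torus_cover (h t) = g t" if "t \<in> {0..1}" for t
    using x(3)[OF that] y(3)[OF that] by (simp add: h_def torus_cover_def vec_eq_iff prod_eq_iff)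
  show thesis
  proof (rule that[of h])
    show "path h"
      using x(1) y(1) unfolding path_def h_def by (intro continuous_intros) auto
    show "path_image h \<subseteq> coll_free"
      using g(2) lift by (auto simp: path_image_def image_subset_iff simp flip: torus_cover_in_config_space)
    show "pathfinish h = pathstart h + ((\<chi> i. winding fst g i), (\<chi> i. winding snd g i))"
      by (simp add: h_def pathfinish_def pathstart_def vec_eq_iff flip: x(2) y(2))
  qed (use lift in auto)
qed

lemma winding_Ints:
  assumes pr: "pr \<in> projs" and g: "path g" "path_image g \<subseteq> config_space torus" "pathfinish g = pathstart g"
  shows "winding pr g i \<in> \<int>"
proof -
  obtain x :: "real \<Rightarrow> real" where x: "x 1 - x 0 = winding pr g i"
    "\<And>t. t \<in> {0..1} \<Longrightarrow> pr (g t $ i) = cis (2 * pi * x t)"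
    using lift_component[OF pr g(1,2)] by metis
  have "cis (2 * pi * x 1) = cis (2 * pi * x 0)"
    using x(2)[of 0] x(2)[of 1] g(3) by (simp add: pathfinish_def pathstart_def)
  then show ?thesis using x(1) by (simp add: cis_2pi_eq_iff)
qed

theorem character_via_winding:
  fixes p :: "(complex \<times> complex) ^ 'n::finite"
  assumes p: "p \<in> config_space torus" and \<psi>: "\<psi> \<in> hom (pure_braid_group p) real_group"
  obtains \<alpha> \<beta> :: "'n \<Rightarrow> real" where "\<And>g. g \<in> based_loops (config_space torus) p \<Longrightarrow>
     \<psi> (loop_class (config_space torus) g) =
       (\<Sum>i\<in>UNIV. winding fst g i * \<alpha> i) + (\<Sum>i\<in>UNIV. winding snd g i * \<beta> i)"
proof -
  let ?C = "config_space torus :: ((complex \<times> complex) ^ 'n) set"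
  obtain \<Phi> where hom: "\<And>g h. homotopic_paths ?C g h \<Longrightarrow> \<Phi> g = \<Phi> h"
    and join: "\<And>g h. \<lbrakk>path g; path_image g \<subseteq> ?C; path h; path_image h \<subseteq> ?C; pathfinish g = pathstart h\<rbrakk>
      \<Longrightarrow> \<Phi> (g +++ h) = \<Phi> g + \<Phi> h"
    and loop: "\<And>g. g \<in> based_loops ?C p \<Longrightarrow> \<Phi> g = \<psi> (loop_class ?C g)"
    using character_extends_to_paths[OF path_connected_config_space p] \<psi>
    unfolding pure_braid_group_def by blast
  have cover_path: "path (torus_cover \<circ> g)" "path_image (torus_cover \<circ> g) \<subseteq> ?C"
    if "path g" "path_image g \<subseteq> coll_free" for g
    using that path_continuous_image[OF that(1) continuous_on_torus_cover]
    by (auto simp: path_image_compose torus_cover_in_config_space)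
  interpret cocycle "\<lambda>g. \<Phi> (torus_cover \<circ> g)"
  proof
    fix g h :: "real \<Rightarrow> (real ^ 'n) \<times> (real ^ 'n)"
    assume "path g" "path_image g \<subseteq> coll_free" "path h" "path_image h \<subseteq> coll_free" "pathfinish g = pathstart h"
    then show "\<Phi> (torus_cover \<circ> (g +++ h)) = \<Phi> (torus_cover \<circ> g) + \<Phi> (torus_cover \<circ> h)"
      unfolding path_compose_join by (intro join cover_path) (simp_all add: pathfinish_compose pathstart_compose)
  next
    fix g h :: "real \<Rightarrow> (real ^ 'n) \<times> (real ^ 'n)"
    assume "homotopic_paths coll_free g h"
    then show "\<Phi> (torus_cover \<circ> g) = \<Phi> (torus_cover \<circ> h)"
      by (intro hom homotopic_paths_continuous_image[OF _ continuous_on_torus_cover])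
         (auto simp: torus_cover_in_config_space)
  next
    fix g and l m :: "real ^ 'n"
    assume "l \<in> integral_vecs" "m \<in> integral_vecs"
    then show "\<Phi> (torus_cover \<circ> (\<lambda>t. g t + (l, m))) = \<Phi> (torus_cover \<circ> g)"
      by (simp add: o_def torus_cover_translate)
  qed
  obtain \<alpha> \<beta> :: "'n \<Rightarrow> real" where W:
    "\<forall>g l m. path g \<longrightarrow> path_image g \<subseteq> coll_free \<longrightarrow> l \<in> integral_vecs \<longrightarrow> m \<in> integral_vecs \<longrightarrow>
       pathfinish g = pathstart g + (l, m) \<longrightarrow>
       \<Phi> (torus_cover \<circ> g) = (\<Sum>i\<in>UNIV. l $ i * \<alpha> i) + (\<Sum>i\<in>UNIV. m $ i * \<beta> i)"
    using W_periods by (elim exE) (rule that)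
  show thesis
  proof (rule that)
    fix g assume g: "g \<in> based_loops ?C p"
    note gD = based_loopsD[OF g]
    obtain h where h: "path h" "path_image h \<subseteq> coll_free" "\<And>t. t \<in> {0..1} \<Longrightarrow> torus_cover (h t) = g t"
      "pathfinish h = pathstart h + ((\<chi> i. winding fst g i), (\<chi> i. winding snd g i))"
      using lift_path[OF gD(1,2)] by metis
    \<comment> \<open>The lift projects to \<open>g\<close> only on the unit interval, so the two
      functions are compared up to homotopy instead of being identified.\<close>
    have "homotopic_paths ?C g (torus_cover \<circ> h)"
      using gD h(3) by (intro homotopic_paths_eq) auto
    then have "\<psi> (loop_class ?C g) = \<Phi> (torus_cover \<circ> h)"
      using loop[OF g] hom by metis
    also have "\<dots> = (\<Sum>i\<in>UNIV. winding fst g i * \<alpha> i) + (\<Sum>i\<in>UNIV. winding snd g i * \<beta> i)"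
      using W[rule_format, OF h(1,2) _ _ h(4)] winding_Ints[OF _ gD(1,2)] gD
      by (simp add: integral_vecs_def projs_def)
    finally show "\<psi> (loop_class ?C g) = (\<Sum>i\<in>UNIV. winding fst g i * \<alpha> i) + (\<Sum>i\<in>UNIV. winding snd g i * \<beta> i)" .
  qed
qed

section \<open>Epimorphisms induced by homeomorphisms\<close>

lemma homotopic_conjugate_inverse:
  fixes S :: "'a::real_normed_vector set"
  assumes "path c" "path_image c \<subseteq> S" "path g" "path_image g \<subseteq> S"
    and "pathstart g = pathstart c" "pathfinish g = pathstart c"
  shows "homotopic_paths S (c +++ ((reversepath c +++ (g +++ c)) +++ reversepath c)) g"
proof -
  note [trans] = homotopic_paths_trans
  let ?r = "reversepath c" and ?z = "linepath (pathstart c) (pathstart c)"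
  have "homotopic_paths S (c +++ ((?r +++ (g +++ c)) +++ ?r)) ((c +++ (?r +++ (g +++ c))) +++ ?r)"
    by (rule homotopic_paths_assoc) (use assms in \<open>auto simp: path_image_join\<close>)
  also have "homotopic_paths S (c +++ (?r +++ (g +++ c))) ((c +++ ?r) +++ (g +++ c))"
    by (rule homotopic_paths_assoc) (use assms in \<open>auto simp: path_image_join\<close>)
  then have "homotopic_paths S ((c +++ (?r +++ (g +++ c))) +++ ?r) (((c +++ ?r) +++ (g +++ c)) +++ ?r)"
    by (rule homotopic_paths_join_left) (use assms in auto)
  also have "homotopic_paths S ((c +++ ?r) +++ (g +++ c)) (?z +++ (g +++ c))"
    by (rule homotopic_paths_join_left[OF homotopic_paths_rinv]) (use assms in \<open>auto simp: path_image_join\<close>)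
  then have "homotopic_paths S (((c +++ ?r) +++ (g +++ c)) +++ ?r) ((?z +++ (g +++ c)) +++ ?r)"
    by (rule homotopic_paths_join_left) (use assms in auto)
  also have "homotopic_paths S (?z +++ (g +++ c)) (g +++ c)"
    by (rule homotopic_paths_lid') (use assms in \<open>auto simp: path_image_join\<close>)
  then have "homotopic_paths S ((?z +++ (g +++ c)) +++ ?r) ((g +++ c) +++ ?r)"
    by (rule homotopic_paths_join_left) (use assms in auto)
  also have "homotopic_paths S ((g +++ c) +++ ?r) (g +++ (c +++ ?r))"
    by (rule homotopic_paths_sym, rule homotopic_paths_assoc) (use assms in auto)
  also have "homotopic_paths S (g +++ (c +++ ?r)) (g +++ ?z)"
    by (rule homotopic_paths_join_right[OF homotopic_paths_rinv]) (use assms in auto)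
  also have "homotopic_paths S (g +++ ?z) g"
    by (rule homotopic_paths_rid') (use assms in auto)
  finally show ?thesis .
qed

lemma some_in_loop_class:
  assumes "path f" "path_image f \<subseteq> S"
  shows "homotopic_paths S f (SOME g. g \<in> loop_class S f)"
  unfolding loop_class_def mem_Collect_eq by (rule someI[of _ f]) (use assms in simp)

text \<open>\<open>F\<close> moves the base point to \<open>F p\<close>, and the path
  \<open>c\<close> brings loops back to \<open>p\<close>. Both operations can be undone up to
  homotopy, which yields surjectivity.\<close>

lemma induced_epimorphism:
  fixes S :: "'a::real_normed_vector set"
  assumes F: "continuous_on S F" "F \<in> S \<rightarrow> S" and F': "continuous_on S F'" "F' \<in> S \<rightarrow> S"
    and inv: "\<And>x. x \<in> S \<Longrightarrow> F (F' x) = x" "\<And>x. x \<in> S \<Longrightarrow> F' (F x) = x"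
    and c: "path c" "path_image c \<subseteq> S" "pathstart c = p" "pathfinish c = F p"
  obtains \<phi> where "\<phi> \<in> hom (fundamental_group S p) (fundamental_group S p)"
    "\<phi> ` carrier (fundamental_group S p) = carrier (fundamental_group S p)"
    "\<And>f. f \<in> based_loops S p \<Longrightarrow> \<phi> (loop_class S f) = loop_class S (c +++ ((F \<circ> f) +++ reversepath c))"
proof -
  define cj where "cj f = c +++ ((F \<circ> f) +++ reversepath c)" for f
  have p: "p \<in> S" using c pathstart_in_path_image by blast
  have Ff: "path (F \<circ> f)" "path_image (F \<circ> f) \<subseteq> S" "pathstart (F \<circ> f) = F p" "pathfinish (F \<circ> f) = F p"
    if "f \<in> based_loops S p" for f
    using based_loopsD[OF that] F
    by (auto simp: path_image_compose pathstart_compose pathfinish_compose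
        intro!: path_continuous_image intro: continuous_on_subset)
  have cj: "cj f \<in> based_loops S p" if "f \<in> based_loops S p" for f
    using Ff[OF that] c by (simp add: cj_def based_loops_def path_image_join)
  \<comment> \<open>Group elements are sets of loops, so an arbitrary representative is used. The
    class of the result does not depend on it because \<open>F\<close> and conjugation by
    \<open>c\<close> respect homotopies.\<close>
  define \<phi> where "\<phi> A = loop_class S (cj (SOME g. g \<in> A))" for A
  have \<phi>: "\<phi> (loop_class S f) = loop_class S (cj f)" if f: "f \<in> based_loops S p" for f
  proof -
    let ?g = "SOME g. g \<in> loop_class S f"
    have "homotopic_paths S (F \<circ> f) (F \<circ> ?g)"
      by (rule homotopic_paths_continuous_image[OF some_in_loop_class F]) (use based_loopsD[OF f] in auto)
    then have "homotopic_paths S (cj f) (cj ?g)"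
      unfolding cj_def using c Ff[OF f] homotopic_paths_imp_pathfinish
      by (intro homotopic_paths_join_right homotopic_paths_join_left) auto
    then show ?thesis unfolding \<phi>_def by (simp add: loop_class_cong)
  qed
  show thesis
  proof (rule that[of \<phi>])
    show "\<phi> \<in> hom (fundamental_group S p) (fundamental_group S p)"
    proof (rule homI)
      fix x assume "x \<in> carrier (fundamental_group S p)"
      then show "\<phi> x \<in> carrier (fundamental_group S p)"
        using \<phi> cj by (auto simp: carrier_fundamental_group)
    next
      fix x y assume "x \<in> carrier (fundamental_group S p)" "y \<in> carrier (fundamental_group S p)"
      then obtain f g where f: "x = loop_class S f" "f \<in> based_loops S p"
        and g: "y = loop_class S g" "g \<in> based_loops S p"
        by (auto simp: carrier_fundamental_group)
      have "homotopic_paths S (cj f +++ cj g) (cj (f +++ g))"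
        unfolding cj_def path_compose_join
        by (rule homotopic_conjugate_join) (use c Ff[OF f(2)] Ff[OF g(2)] in auto)
      then show "\<phi> (x \<otimes>\<^bsub>fundamental_group S p\<^esub> y) = \<phi> x \<otimes>\<^bsub>fundamental_group S p\<^esub> \<phi> y"
        using f g by (simp add: mult_fundamental_group \<phi> cj based_loops_join loop_class_cong)
    qed
    have "loop_class S g \<in> \<phi> ` carrier (fundamental_group S p)" if g: "g \<in> based_loops S p" for g
    proof -
      \<comment> \<open>This loop at \<open>F p\<close> is \<open>g\<close> conjugated back along
        \<open>c\<close>; its image under \<open>F'\<close> is the loop at \<open>p\<close> whose
        class is sent to that of \<open>g\<close>.\<close>
      let ?h = "reversepath c +++ (g +++ c)"
      have h: "path ?h" "path_image ?h \<subseteq> S" "pathstart ?h = F p" "pathfinish ?h = F p"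
        using c based_loopsD[OF g] by (auto simp: path_image_join)
      have f: "F' \<circ> ?h \<in> based_loops S p"
        using h F' inv(2)[OF p]
        by (auto simp: based_loops_def path_image_compose pathstart_compose pathfinish_compose
            intro!: path_continuous_image intro: continuous_on_subset)
      have "F (F' (?h t)) = ?h t" if "t \<in> {0..1}" for t
        by (rule inv(1)) (use h(2) that in \<open>auto simp: path_image_def\<close>)
      then have "homotopic_paths S ?h (F \<circ> (F' \<circ> ?h))"
        using h by (intro homotopic_paths_eq) auto
      then have "homotopic_paths S (c +++ (?h +++ reversepath c)) (cj (F' \<circ> ?h))"
        unfolding cj_def using c h
        by (intro homotopic_paths_join_right homotopic_paths_join_left) auto
      moreover have "homotopic_paths S (c +++ (?h +++ reversepath c)) g"
        using c based_loopsD[OF g] by (intro homotopic_conjugate_inverse) auto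
      ultimately have "loop_class S g = \<phi> (loop_class S (F' \<circ> ?h))"
        using \<phi>[OF f] loop_class_cong by metis
      then show ?thesis using loop_class_in_carrier[OF f] by blast
    qed
    then show "\<phi> ` carrier (fundamental_group S p) = carrier (fundamental_group S p)"
      using \<phi> cj by (auto simp: carrier_fundamental_group)
  qed (use \<phi> in \<open>simp add: cj_def\<close>)
qed

text \<open>Relabelling the strings permutes the winding numbers. The path back to the base point is
  traversed once in each direction, so by additivity on open paths it leaves no trace in
  them.\<close>

lemma permutation_epimorphism:
  fixes p :: "(complex \<times> complex) ^ 'n::finite" and \<tau> :: "'n \<Rightarrow> 'n"
  assumes p: "p \<in> config_space torus" and \<tau>: "bij \<tau>"
  obtains \<phi> where "\<phi> \<in> hom (pure_braid_group p) (pure_braid_group p)"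
    "\<phi> ` carrier (pure_braid_group p) = carrier (pure_braid_group p)"
    "\<And>f. f \<in> based_loops (config_space torus) p \<Longrightarrow> \<exists>g\<in>based_loops (config_space torus) p.
       \<phi> (loop_class (config_space torus) f) = loop_class (config_space torus) g \<and>
       (\<forall>pr\<in>projs. \<forall>i. winding pr g i = winding pr f (\<tau> i))"
proof -
  let ?C = "config_space torus :: ((complex \<times> complex) ^ 'n) set"
  define F where "F \<sigma> x = (\<chi> i. x $ \<sigma> i)" for \<sigma> :: "'n \<Rightarrow> 'n" and x :: "(complex \<times> complex) ^ 'n"
  have F: "continuous_on ?C (F \<sigma>)" "F \<sigma> \<in> ?C \<rightarrow> ?C" if "bij \<sigma>" for \<sigma>
  proof -
    show "continuous_on ?C (F \<sigma>)" unfolding F_def by (intro continuous_intros)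
    show "F \<sigma> \<in> ?C \<rightarrow> ?C"
      using bij_is_inj[OF that] by (auto simp: F_def config_space_def inj_eq)
  qed
  have "F \<tau> p \<in> ?C" using F(2)[OF \<tau>] p by blast
  then obtain c where c: "path c" "path_image c \<subseteq> ?C" "pathstart c = p" "pathfinish c = F \<tau> p"
    using path_connected_config_space p unfolding path_connected_def by blast
  have inv: "F \<tau> (F (inv_into UNIV \<tau>) x) = x" "F (inv_into UNIV \<tau>) (F \<tau> x) = x" for x
    using \<tau> by (simp_all add: F_def vec_eq_iff bij_is_inj bij_is_surj surj_f_inv_f)
  obtain \<phi> where \<phi>: "\<phi> \<in> hom (fundamental_group ?C p) (fundamental_group ?C p)"
    "\<phi> ` carrier (fundamental_group ?C p) = carrier (fundamental_group ?C p)"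
    "\<And>f. f \<in> based_loops ?C p \<Longrightarrow> \<phi> (loop_class ?C f) = loop_class ?C (c +++ ((F \<tau> \<circ> f) +++ reversepath c))"
    using induced_epimorphism[OF F[OF \<tau>] F[OF bij_imp_bij_inv[OF \<tau>]] inv c] by blast
  show thesis
  proof (rule that[of \<phi>])
    fix f assume f: "f \<in> based_loops ?C p"
    have Ff: "path (F \<tau> \<circ> f)" "path_image (F \<tau> \<circ> f) \<subseteq> ?C" "pathstart (F \<tau> \<circ> f) = F \<tau> p" "pathfinish (F \<tau> \<circ> f) = F \<tau> p"
      using based_loopsD[OF f] F[OF \<tau>]
      by (auto simp: path_image_compose pathstart_compose pathfinish_compose
          intro!: path_continuous_image intro: continuous_on_subset)
    let ?g = "c +++ ((F \<tau> \<circ> f) +++ reversepath c)"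
    have "?g \<in> based_loops ?C p"
      using Ff c by (simp add: based_loops_def path_image_join)
    moreover have "winding pr ?g i = winding pr f (\<tau> i)" if pr: "pr \<in> projs" for pr i
    proof -
      have "winding pr ?g i = winding pr c i + (winding pr (F \<tau> \<circ> f) i + winding pr (reversepath c) i)"
        using Ff c by (simp add: winding_join pr path_image_join)
      also have "\<dots> = winding pr (F \<tau> \<circ> f) i" using c by (simp add: winding_reversepath pr)
      also have "\<dots> = winding pr f (\<tau> i)" by (simp add: winding_def F_def)
      finally show ?thesis .
    qed
    ultimately show "\<exists>g\<in>based_loops ?C p. \<phi> (loop_class ?C f) = loop_class ?C g \<and>
        (\<forall>pr\<in>projs. \<forall>i. winding pr g i = winding pr f (\<tau> i))"
      using \<phi>(3)[OF f] by blast
  qed (use \<phi> in \<open>simp_all add: pure_braid_group_def\<close>)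
qed

section \<open>Winding numbers of braids with one moving string\<close>

lemma winding_number_rotation:
  assumes "z \<noteq> 0"
  shows "winding_number (\<lambda>t. z * cis (2 * pi * t)) 0 = 1"
proof -
  let ?q = "\<lambda>t::real. Ln z + \<i> * of_real (2 * pi * t)"
  have "path ?q" unfolding path_def by (intro continuous_intros)
  moreover have "(\<lambda>t. z * cis (2 * pi * t)) = exp \<circ> ?q"
    using assms by (auto simp: exp_add cis_conv_exp)
  ultimately show ?thesis
    using winding_number_compose_exp[of ?q] by (simp add: pathfinish_def pathstart_def)
qed

text \<open>The homotopy between \<open>l\<close> and \<open>g\<close> takes place in the whole
  torus and may cross the other base points. This does no harm, since a single winding number only
  sees the projection of one string to a circle.\<close>

lemma winding_single_string:
  assumes p: "p \<in> config_space torus" and g: "string_loop p i l g" and pr: "pr \<in> projs"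
  shows "winding pr (\<lambda>t. \<chi> j. if j = i then g t else p $ j) k =
    (if k = i then Re (winding_number (pr \<circ> l) 0) else 0)"
proof (cases "k = i")
  case True
  have "pr \<in> torus \<rightarrow> - {0}" "continuous_on torus pr"
    using pr by (auto simp: projs_def torus_def intro!: continuous_intros)
  then have "homotopic_paths (- {0}) (pr \<circ> l) (pr \<circ> g)"
    using g by (intro homotopic_paths_continuous_image) (auto simp: string_loop_def)
  then show ?thesis
    using True winding_number_homotopic_paths by (simp add: winding_def o_def)
next
  case False
  have "pr (p $ k) \<noteq> 0" using norm_proj[OF pr p, of k] by auto
  then show ?thesis
    using False winding_number_constI[of "pr (p $ k)" 0 "\<lambda>t. pr (p $ k)"] by (simp add: winding_def)
qed

lemma single_string_based_loop:
  assumes p: "p \<in> config_space torus" and g: "string_loop p i l g"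
  shows "(\<lambda>t. \<chi> j. if j = i then g t else p $ j) \<in> based_loops (config_space torus) p"
proof -
  have g': "path g" "path_image g \<subseteq> torus - {p $ j | j. j \<noteq> i}" "pathstart g = p $ i" "pathfinish g = p $ i"
    using g by (auto simp: string_loop_def based_loops_def)
  have "path (\<lambda>t. \<chi> j. if j = i then g t else p $ j)"
    unfolding path_def
  proof (intro continuous_on_vec_lambda)
    show "continuous_on {0..1} (\<lambda>t. if j = i then g t else p $ j)" for j
      using g'(1) by (cases "j = i") (simp_all add: path_def)
  qed
  moreover have "(\<chi> j. if j = i then g t else p $ j) \<in> config_space torus" if "t \<in> {0..1}" for t
  proof -
    have "g t \<in> torus - {p $ j | j. j \<noteq> i}"
      using g'(2) that unfolding path_image_def by blast
    then have "g t \<in> torus" "\<And>j. j \<noteq> i \<Longrightarrow> g t \<noteq> p $ j" "\<And>j. j \<noteq> i \<Longrightarrow> p $ j \<noteq> g t"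
      by auto
    then show ?thesis
      using p by (auto simp: config_space_def)
  qed
  ultimately show ?thesis
    using g'(3,4) by (auto simp: based_loops_def path_image_def pathstart_def pathfinish_def vec_eq_iff)
qed

text \<open>Membership is respected in both directions, so every preimage in \<open>S\<close> of a
  point of \<open>B\<close> already lies in \<open>B\<close>. The same holds for the
  complement.\<close>

lemma image_invariant_subset:
  assumes "P ` S = S" "B \<subseteq> S" "\<And>c. c \<in> S \<Longrightarrow> P c \<in> B \<longleftrightarrow> c \<in> B"
  shows "P ` B = B" "P ` (S - B) = S - B"
proof -
  have inv: "P ` T = T" if T: "T \<subseteq> S" "\<And>c. c \<in> S \<Longrightarrow> P c \<in> T \<longleftrightarrow> c \<in> T" for T
  proof
    show "P ` T \<subseteq> T" using T by blast
    show "T \<subseteq> P ` T"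
    proof
      fix x assume x: "x \<in> T"
      then have "x \<in> P ` S" using T(1) assms(1) by blast
      then obtain c where "c \<in> S" "x = P c" by blast
      then show "x \<in> P ` T" using T(2) x by blast
    qed
  qed
  show "P ` B = B" by (rule inv) (use assms in auto)
  show "P ` (S - B) = S - B" by (rule inv) (use assms in auto)
qed

section \<open>Permuting the strings\<close>

locale torus_braids =
  fixes p :: "(complex \<times> complex) ^ 'n::finite"
    and \<alpha> \<beta> :: "'n \<Rightarrow> real \<Rightarrow> complex \<times> complex"
    and a b :: "'n \<Rightarrow> (real \<Rightarrow> (complex \<times> complex) ^ 'n) set"
  assumes base_point: "p \<in> config_space torus"
    and loops_a: "\<And>i. string_loop p i (torus_loop_a (p $ i)) (\<alpha> i)"
    and loops_b: "\<And>i. string_loop p i (torus_loop_b (p $ i)) (\<beta> i)"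
    and a: "\<And>i. a i = single_string_braid p i (\<alpha> i)"
    and b: "\<And>i. b i = single_string_braid p i (\<beta> i)"
begin

abbreviation C :: "((complex \<times> complex) ^ 'n) set" where "C \<equiv> config_space torus"
abbreviation G where "G \<equiv> pure_braid_group p"

lemma group_G: "group G"
  unfolding pure_braid_group_def using base_point by (rule group_fundamental_group)

lemma carrier_G: "carrier G = loop_class C ` based_loops C p"
  by (simp add: pure_braid_group_def carrier_fundamental_group)

text \<open>The winding numbers of the strings form the basis dual to the \<open>a i\<close> and
  \<open>b i\<close>; this duality converts coefficients of winding numbers into coordinates of
  characters.\<close>

lemma winding_generators:
  obtains f g where "\<And>i. f i \<in> based_loops C p" "\<And>i. g i \<in> based_loops C p"
    "\<And>i. a i = loop_class C (f i)" "\<And>i. b i = loop_class C (g i)"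
    "\<And>i k. winding fst (f i) k = (if k = i then 1 else 0)" "\<And>i k. winding snd (f i) k = 0"
    "\<And>i k. winding fst (g i) k = 0" "\<And>i k. winding snd (g i) k = (if k = i then 1 else 0)"
proof -
  have pr: "fst \<in> projs" "snd \<in> projs" by (auto simp: projs_def)
  have nz: "fst (p $ i) \<noteq> 0" "snd (p $ i) \<noteq> 0" for i
    using norm_proj[OF pr(1) base_point, of i] norm_proj[OF pr(2) base_point, of i] by auto
  have const: "winding_number (\<lambda>t. z) 0 = 0" if "z \<noteq> 0" for z :: complex
    using that by (simp add: winding_number_constI)
  show thesis
    by (rule that[of "\<lambda>i t. \<chi> j. if j = i then \<alpha> i t else p $ j" "\<lambda>i t. \<chi> j. if j = i then \<beta> i t else p $ j"])
       (simp_all add: a b single_string_braid_def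
          single_string_based_loop[OF base_point loops_a] single_string_based_loop[OF base_point loops_b]
          winding_single_string[OF base_point loops_a] winding_single_string[OF base_point loops_b] pr
          o_def torus_loop_a_def torus_loop_b_def winding_number_rotation nz const)
qed

lemma generators_in_carrier: "a i \<in> carrier G" "b i \<in> carrier G"
  using winding_generators carrier_G by (metis imageI)+

text \<open>Provides a character with arbitrarily prescribed coordinates. The choice of a
  representative is harmless by homotopy invariance of the winding numbers.\<close>

definition winding_char :: "('n \<Rightarrow> real) \<Rightarrow> ('n \<Rightarrow> real) \<Rightarrow> (real \<Rightarrow> (complex \<times> complex) ^ 'n) set \<Rightarrow> real" where
  "winding_char u v A = (let g = SOME g. g \<in> A in (\<Sum>i\<in>UNIV. winding fst g i * u i) + (\<Sum>i\<in>UNIV. winding snd g i * v i))"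

lemma winding_char_loop_class:
  assumes "f \<in> based_loops C p"
  shows "winding_char u v (loop_class C f) = (\<Sum>i\<in>UNIV. winding fst f i * u i) + (\<Sum>i\<in>UNIV. winding snd f i * v i)"
proof -
  have "homotopic_paths C f (SOME g. g \<in> loop_class C f)"
    using some_in_loop_class based_loopsD[OF assms] by blast
  then have "winding pr f i = winding pr (SOME g. g \<in> loop_class C f) i" if "pr \<in> projs" for pr i
    using winding_homotopic[OF that] by blast
  then show ?thesis by (simp add: winding_char_def projs_def Let_def)
qed

lemma winding_char_hom: "winding_char u v \<in> hom G real_group"
  unfolding hom_real_group_iff carrier_G
proof (intro ballI)
  fix x y assume "x \<in> loop_class C ` based_loops C p" "y \<in> loop_class C ` based_loops C p"
  then obtain f g where f: "x = loop_class C f" "f \<in> based_loops C p"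
    and g: "y = loop_class C g" "g \<in> based_loops C p"
    by blast
  have "winding pr (f +++ g) i = winding pr f i + winding pr g i" if "pr \<in> projs" for pr i
    using that based_loopsD[OF f(2)] based_loopsD[OF g(2)] by (intro winding_join) auto
  then show "winding_char u v (x \<otimes>\<^bsub>G\<^esub> y) = winding_char u v x + winding_char u v y"
    using f g by (simp add: pure_braid_group_def mult_fundamental_group winding_char_loop_class based_loops_join projs_def
        sum.distrib distrib_right)
qed

lemma winding_char_generators: "winding_char u v (a i) = u i" "winding_char u v (b i) = v i"
proof -
  obtain f g where *: "\<And>i. f i \<in> based_loops C p" "\<And>i. g i \<in> based_loops C p"
    "\<And>i. a i = loop_class C (f i)" "\<And>i. b i = loop_class C (g i)"
    "\<And>i k. winding fst (f i) k = (if k = i then 1 else 0)" "\<And>i k. winding snd (f i) k = 0"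
    "\<And>i k. winding fst (g i) k = 0" "\<And>i k. winding snd (g i) k = (if k = i then 1 else 0)"
    using winding_generators by blast
  show "winding_char u v (a i) = u i" "winding_char u v (b i) = v i"
    by (simp_all add: * winding_char_loop_class if_distrib[of "\<lambda>x. x * _"] cong: if_cong)
qed

text \<open>Some coefficients exist by \<open>character_via_winding\<close>; evaluation at the
  generators, where the winding numbers are dual, identifies them.\<close>

lemma character_eq_winding_char:
  assumes \<psi>: "\<psi> \<in> hom G real_group" and A: "A \<in> carrier G"
  shows "\<psi> A = winding_char (\<lambda>i. \<psi> (a i)) (\<lambda>i. \<psi> (b i)) A"
proof -
  obtain u v where uv: "\<And>g. g \<in> based_loops C p \<Longrightarrow> \<psi> (loop_class C g) =
      (\<Sum>i\<in>UNIV. winding fst g i * u i) + (\<Sum>i\<in>UNIV. winding snd g i * v i)"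
    using character_via_winding[OF base_point \<psi>] by blast
  have "\<psi> A = winding_char u v A" if "A \<in> carrier G" for A
    using that uv winding_char_loop_class by (auto simp: carrier_G)
  then show ?thesis
    using A by (simp add: generators_in_carrier winding_char_generators)
qed

lemma character_eqI:
  assumes "\<psi> \<in> hom G real_group" "\<psi>' \<in> hom G real_group"
    and "\<And>i. \<psi>' (a i) = \<psi> (a i)" "\<And>i. \<psi>' (b i) = \<psi> (b i)" and "A \<in> carrier G"
  shows "\<psi>' A = \<psi> A"
  using character_eq_winding_char[of \<psi> A] character_eq_winding_char[of \<psi>' A] assms by simp

section \<open>Coordinates on the character sphere\<close>

definition char_coords :: "((real \<Rightarrow> (complex \<times> complex) ^ 'n) set \<Rightarrow> real) \<Rightarrow> (real ^ 'n) \<times> (real ^ 'n)" where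
  "char_coords \<psi> = ((\<chi> i. \<psi> (a i)), (\<chi> i. \<psi> (b i)))"

lemma char_coords_nonzero:
  assumes "\<psi> \<in> nonzero_characters G" shows "char_coords \<psi> \<noteq> 0"
proof
  assume 0: "char_coords \<psi> = 0"
  have \<psi>: "\<psi> \<in> hom G real_group" using assms by (simp add: nonzero_characters_def)
  have "\<psi> A = 0" if "A \<in> carrier G" for A
    by (rule character_eqI[OF _ \<psi> _ _ that, of "\<lambda>_. 0"])
      (use 0 in \<open>auto simp: hom_real_group_iff char_coords_def vec_eq_iff prod_eq_iff\<close>)
  then show False using assms by (auto simp: nonzero_characters_def)
qed

abbreviation char_class where "char_class \<psi> \<equiv> character_rel G `` {\<psi>}"

lemma char_class_eqI:
  assumes "\<psi> \<in> nonzero_characters G" "\<psi>' \<in> nonzero_characters G" "r > 0"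
    and "\<And>A. A \<in> carrier G \<Longrightarrow> \<psi>' A = r * \<psi> A"
  shows "char_class \<psi>' = char_class \<psi>"
proof -
  have "(\<exists>s>0. \<forall>A\<in>carrier G. f A = s * \<psi>' A) \<longleftrightarrow> (\<exists>s>0. \<forall>A\<in>carrier G. f A = s * \<psi> A)" for f
  proof
    assume "\<exists>s>0. \<forall>A\<in>carrier G. f A = s * \<psi>' A"
    then obtain s where "s > 0" "\<forall>A\<in>carrier G. f A = s * \<psi>' A" by blast
    then show "\<exists>s>0. \<forall>A\<in>carrier G. f A = s * \<psi> A"
      using assms by (intro exI[of _ "s * r"]) auto
  next
    assume "\<exists>s>0. \<forall>A\<in>carrier G. f A = s * \<psi> A"
    then obtain s where "s > 0" "\<forall>A\<in>carrier G. f A = s * \<psi> A" by blast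
    then show "\<exists>s>0. \<forall>A\<in>carrier G. f A = s * \<psi>' A"
      using assms by (intro exI[of _ "s / r"]) auto
  qed
  then show ?thesis using assms by (auto simp: character_rel_def)
qed

lemma self_in_char_class: "\<psi> \<in> nonzero_characters G \<Longrightarrow> \<psi> \<in> char_class \<psi>"
  by (auto simp: character_rel_def intro: exI[of _ 1])

lemma character_sphere_eq: "character_sphere G = char_class ` nonzero_characters G"
  by (auto simp: character_sphere_def quotient_def)

lemma sphere_coords_char_class:
  assumes "\<psi> \<in> nonzero_characters G"
  shows "sphere_coords a b (char_class \<psi>) = sgn (char_coords \<psi>)"
proof -
  have "sgn (char_coords f) = sgn (char_coords \<psi>)" if f: "f \<in> char_class \<psi>" for f
  proof -
    obtain r where "r > 0" "\<And>A. A \<in> carrier G \<Longrightarrow> f A = r * \<psi> A"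
      using f unfolding character_rel_def by blast
    then have "char_coords f = r *\<^sub>R char_coords \<psi>"
      by (simp add: char_coords_def generators_in_carrier vec_eq_iff)
    then show ?thesis using \<open>r > 0\<close> by (simp add: sgn_scaleR)
  qed
  then have "(\<lambda>f. sgn (char_coords f)) ` char_class \<psi> = {sgn (char_coords \<psi>)}"
    using self_in_char_class[OF assms] by blast
  then show ?thesis by (simp add: sphere_coords_def char_coords_def)
qed

text \<open>Equal normalizations make the coordinate vectors positive multiples of each other. As
  the coordinates determine a character, the same factor relates the characters on all of
  \<open>G\<close>.\<close>

lemma inj_on_sphere_coords: "inj_on (sphere_coords a b) (character_sphere G)"
  unfolding character_sphere_eq
proof (rule inj_onI, clarify)
  fix \<psi> \<psi>' assume \<psi>: "\<psi> \<in> nonzero_characters G" and \<psi>': "\<psi>' \<in> nonzero_characters G"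
    and "sphere_coords a b (char_class \<psi>) = sphere_coords a b (char_class \<psi>')"
  then have eq: "sgn (char_coords \<psi>) = sgn (char_coords \<psi>')" by (simp add: sphere_coords_char_class)
  define r where "r = norm (char_coords \<psi>') / norm (char_coords \<psi>)"
  have nz: "norm (char_coords \<psi>) > 0" "norm (char_coords \<psi>') > 0" using char_coords_nonzero \<psi> \<psi>' by auto
  have "char_coords \<psi>' = norm (char_coords \<psi>') *\<^sub>R sgn (char_coords \<psi>')" using nz by (simp add: sgn_div_norm)
  also have "\<dots> = norm (char_coords \<psi>') *\<^sub>R sgn (char_coords \<psi>)" by (simp only: eq)
  also have "\<dots> = r *\<^sub>R char_coords \<psi>" by (simp add: sgn_div_norm r_def divide_inverse)
  finally have vr: "char_coords \<psi>' = r *\<^sub>R char_coords \<psi>" .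
  have hom: "\<psi> \<in> hom G real_group" "\<psi>' \<in> hom G real_group"
    using \<psi> \<psi>' by (auto simp: nonzero_characters_def)
  have "\<psi>' A = r * \<psi> A" if "A \<in> carrier G" for A
    by (rule character_eqI[OF _ hom(2) _ _ that, of "\<lambda>A. r * \<psi> A"])
      (use hom(1) vr in \<open>auto simp: hom_real_group_iff distrib_left char_coords_def vec_eq_iff\<close>)
  then show "char_class \<psi> = char_class \<psi>'"
    using char_class_eqI[OF \<psi> \<psi>', of r] nz by (simp add: r_def)
qed

text \<open>A lift of the permutation from the sphere to individual characters, available because
  every coordinate vector is realized by some \<open>winding_char\<close>.\<close>

definition perm_char :: "('n \<Rightarrow> 'n) \<Rightarrow> ((real \<Rightarrow> (complex \<times> complex) ^ 'n) set \<Rightarrow> real) \<Rightarrow>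
    (real \<Rightarrow> (complex \<times> complex) ^ 'n) set \<Rightarrow> real" where
  "perm_char \<tau> \<psi> = winding_char (\<lambda>i. \<psi> (a (\<tau> i))) (\<lambda>i. \<psi> (b (\<tau> i)))"

lemma char_coords_perm_char: "char_coords (perm_char \<tau> \<psi>) = permute_coords \<tau> (char_coords \<psi>)"
  by (simp add: char_coords_def perm_char_def winding_char_generators permute_coords_def)

lemma nonzero_perm_char:
  assumes \<tau>: "bij \<tau>" and \<psi>: "\<psi> \<in> nonzero_characters G"
  shows "perm_char \<tau> \<psi> \<in> nonzero_characters G"
proof -
  have "\<exists>i. \<psi> (a i) \<noteq> 0 \<or> \<psi> (b i) \<noteq> 0"
    using char_coords_nonzero[OF \<psi>] by (auto simp: char_coords_def vec_eq_iff prod_eq_iff)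
  then obtain i where "\<psi> (a (\<tau> i)) \<noteq> 0 \<or> \<psi> (b (\<tau> i)) \<noteq> 0"
    using bij_is_surj[OF \<tau>] by (metis surjD)
  then have "perm_char \<tau> \<psi> (a i) \<noteq> 0 \<or> perm_char \<tau> \<psi> (b i) \<noteq> 0"
    by (simp add: perm_char_def winding_char_generators)
  then show ?thesis
    using generators_in_carrier winding_char_hom by (auto simp: nonzero_characters_def perm_char_def)
qed

lemma sgn_permute_coords:
  fixes \<tau> :: "'n \<Rightarrow> 'n" and v :: "(real ^ 'n) \<times> (real ^ 'n)"
  assumes "bij \<tau>"
  shows "permute_coords \<tau> (sgn v) = sgn (permute_coords \<tau> v)"
proof -
  have "norm (\<chi> i. x $ \<tau> i) = norm x" for x :: "real ^ 'n"
    using sum.reindex_bij_betw[OF assms, of "\<lambda>i. (norm (x $ i))\<^sup>2"]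
    by (simp add: norm_vec_def L2_set_def)
  then have "norm (permute_coords \<tau> v) = norm v"
    by (cases v) (simp add: permute_coords_def norm_Pair)
  then show ?thesis
    by (cases v) (simp add: sgn_div_norm permute_coords_def vec_eq_iff)
qed

lemma permute_character_sphere_char_class:
  assumes "bij \<tau>" "\<psi> \<in> nonzero_characters G"
  shows "permute_character_sphere G a b \<tau> (char_class \<psi>) = char_class (perm_char \<tau> \<psi>)"
  unfolding permute_character_sphere_def
  by (rule inv_into_f_eq[OF inj_on_sphere_coords])
     (use assms in \<open>auto simp: character_sphere_eq nonzero_perm_char sphere_coords_char_class
        sgn_permute_coords char_coords_perm_char\<close>)

lemma perm_char_inv:
  assumes "bij \<tau>" "\<psi> \<in> nonzero_characters G" "A \<in> carrier G"
  shows "perm_char \<tau> (perm_char (inv_into UNIV \<tau>) \<psi>) A = \<psi> A"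
    and "perm_char (inv_into UNIV \<tau>) (perm_char \<tau> \<psi>) A = \<psi> A"
  using assms
  by (auto simp: perm_char_def winding_char_generators nonzero_characters_def bij_is_inj bij_is_surj surj_f_inv_f
      simp flip: character_eq_winding_char)

lemma char_class_perm_char_inv:
  assumes "bij \<tau>" "\<psi> \<in> nonzero_characters G"
  shows "char_class (perm_char \<tau> (perm_char (inv_into UNIV \<tau>) \<psi>)) = char_class \<psi>"
  by (rule char_class_eqI[of _ _ 1])
     (use assms in \<open>auto simp: nonzero_perm_char bij_imp_bij_inv perm_char_inv\<close>)

section \<open>Connectivity of half-spaces under permutations\<close>

abbreviation conn where
  "conn X \<psi> \<equiv> full_subgraph_connected (cayley_edges G X) {g \<in> carrier G. \<psi> g \<ge> 0}"

text \<open>A positive factor does not change the sign of a character, so all representatives of a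
  class define the same half-space.\<close>

lemma char_class_in_BNS_iff:
  assumes "\<psi> \<in> nonzero_characters G"
  shows "char_class \<psi> \<in> BNS_Sigma1 G X \<longleftrightarrow> conn X \<psi>"
proof
  assume "char_class \<psi> \<in> BNS_Sigma1 G X"
  then obtain f where f: "char_class \<psi> = char_class f" "conn X f"
    by (auto simp: BNS_Sigma1_def)
  then have "\<psi> \<in> char_class f" using self_in_char_class[OF assms] by simp
  then obtain r where "r > 0" "\<And>A. A \<in> carrier G \<Longrightarrow> \<psi> A = r * f A"
    by (auto simp: character_rel_def)
  then have "{g \<in> carrier G. \<psi> g \<ge> 0} = {g \<in> carrier G. f g \<ge> 0}"
    by (auto simp: zero_le_mult_iff)
  then show "conn X \<psi>" using f by simp
qed (use assms in \<open>auto simp: BNS_Sigma1_def\<close>)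

text \<open>Composing \<open>perm_char \<tau> \<psi>\<close> with the epimorphism that relabels the
  strings by \<open>\<tau>\<close> gives back \<open>\<psi>\<close>: both permute the same indices,
  and reindexing the sums by \<open>\<tau>\<close> removes the permutation. So the pulled-back
  half-space is that of \<open>\<psi>\<close>.\<close>

lemma connected_perm_char:
  assumes X: "finite X" "X \<subseteq> carrier G" "generate G X = carrier G"
    and \<tau>: "bij \<tau>" and \<psi>: "\<psi> \<in> nonzero_characters G" and conn: "conn X \<psi>"
  shows "conn X (perm_char \<tau> \<psi>)"
proof -
  obtain \<phi> where \<phi>: "\<phi> \<in> hom G G" "\<phi> ` carrier G = carrier G"
    "\<And>f. f \<in> based_loops C p \<Longrightarrow> \<exists>g\<in>based_loops C p. \<phi> (loop_class C f) = loop_class C g \<and>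
       (\<forall>pr\<in>projs. \<forall>i. winding pr g i = winding pr f (\<tau> i))"
    using permutation_epimorphism[OF base_point \<tau>] by blast
  have "perm_char \<tau> \<psi> (\<phi> A) = \<psi> A" if A: "A \<in> carrier G" for A
  proof -
    obtain f where f: "A = loop_class C f" "f \<in> based_loops C p"
      using A by (auto simp: carrier_G)
    obtain g where g: "g \<in> based_loops C p" "\<phi> A = loop_class C g"
      "\<And>i. winding fst g i = winding fst f (\<tau> i)" "\<And>i. winding snd g i = winding snd f (\<tau> i)"
      using \<phi>(3)[OF f(2)] f(1) by (auto simp: projs_def)
    have "perm_char \<tau> \<psi> (\<phi> A) = (\<Sum>i\<in>UNIV. winding fst f (\<tau> i) * \<psi> (a (\<tau> i))) +
        (\<Sum>i\<in>UNIV. winding snd f (\<tau> i) * \<psi> (b (\<tau> i)))"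
      using g by (simp add: perm_char_def winding_char_loop_class)
    also have "\<dots> = winding_char (\<lambda>i. \<psi> (a i)) (\<lambda>i. \<psi> (b i)) A"
      using sum.reindex_bij_betw[OF \<tau>, of "\<lambda>i. winding fst f i * \<psi> (a i)"]
        sum.reindex_bij_betw[OF \<tau>, of "\<lambda>i. winding snd f i * \<psi> (b i)"] f
      by (simp add: winding_char_loop_class)
    also have "\<dots> = \<psi> A"
      using \<psi> A by (simp add: nonzero_characters_def flip: character_eq_winding_char)
    finally show ?thesis .
  qed
  then have "{g \<in> carrier G. perm_char \<tau> \<psi> (\<phi> g) \<ge> 0} = {g \<in> carrier G. \<psi> g \<ge> 0}"
    by auto
  then show ?thesis
    using full_subgraph_connected_epimorphism[OF group_G group_G \<phi>(1,2) X(1,2) X(2,3) nonzero_perm_char[OF \<tau> \<psi>]]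
      conn by simp
qed

lemma connected_perm_char_iff:
  assumes X: "finite X" "X \<subseteq> carrier G" "generate G X = carrier G"
    and \<tau>: "bij \<tau>" and \<psi>: "\<psi> \<in> nonzero_characters G"
  shows "conn X (perm_char \<tau> \<psi>) \<longleftrightarrow> conn X \<psi>"
proof
  assume "conn X (perm_char \<tau> \<psi>)"
  then have "conn X (perm_char (inv_into UNIV \<tau>) (perm_char \<tau> \<psi>))"
    by (rule connected_perm_char[OF X bij_imp_bij_inv[OF \<tau>] nonzero_perm_char[OF \<tau> \<psi>]])
  \<comment> \<open>Permuting back recovers \<open>\<psi>\<close> only on the carrier, hence
    half-spaces are compared and not functions.\<close>
  moreover have "{g \<in> carrier G. perm_char (inv_into UNIV \<tau>) (perm_char \<tau> \<psi>) g \<ge> 0} = {g \<in> carrier G. \<psi> g \<ge> 0}"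
    using perm_char_inv(2)[OF \<tau> \<psi>] by auto
  ultimately show "conn X \<psi>" by (simp only:)
qed (rule connected_perm_char[OF X \<tau> \<psi>])

theorem permute_BNS:
  assumes X: "finite X" "X \<subseteq> carrier G" "generate G X = carrier G" and \<tau>: "bij \<tau>"
  shows "permute_character_sphere G a b \<tau> ` BNS_Sigma1 G X = BNS_Sigma1 G X \<and>
         permute_character_sphere G a b \<tau> ` (character_sphere G - BNS_Sigma1 G X)
           = character_sphere G - BNS_Sigma1 G X"
proof -
  let ?P = "permute_character_sphere G a b \<tau>"
  have sphere: "?P ` character_sphere G = character_sphere G"
  proof
    show "?P ` character_sphere G \<subseteq> character_sphere G"
      by (auto simp: character_sphere_eq permute_character_sphere_char_class nonzero_perm_char \<tau>)
    show "character_sphere G \<subseteq> ?P ` character_sphere G"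
    proof
      fix c assume "c \<in> character_sphere G"
      then obtain \<psi> where \<psi>: "\<psi> \<in> nonzero_characters G" "c = char_class \<psi>" by (auto simp: character_sphere_eq)
      have nz: "perm_char (inv_into UNIV \<tau>) \<psi> \<in> nonzero_characters G"
        by (intro nonzero_perm_char bij_imp_bij_inv \<tau> \<psi>)
      have "c = ?P (char_class (perm_char (inv_into UNIV \<tau>) \<psi>))"
        using \<psi> by (simp add: permute_character_sphere_char_class \<tau> nz char_class_perm_char_inv)
      then show "c \<in> ?P ` character_sphere G"
        using nz by (auto simp: character_sphere_eq)
    qed
  qed
  have iff: "?P c \<in> BNS_Sigma1 G X \<longleftrightarrow> c \<in> BNS_Sigma1 G X" if "c \<in> character_sphere G" for c
    using that by (auto simp: character_sphere_eq permute_character_sphere_char_class \<tau> char_class_in_BNS_iff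
        nonzero_perm_char connected_perm_char_iff[OF X \<tau>])
  have "BNS_Sigma1 G X \<subseteq> character_sphere G"
    by (auto simp: BNS_Sigma1_def character_sphere_eq)
  then show ?thesis
    using image_invariant_subset[OF sphere _ iff] by metis
qed

end

theorem corollary4p4:
  fixes p :: "(complex \<times> complex) ^ 'n::finite"
    and \<alpha> \<beta> :: "'n \<Rightarrow> real \<Rightarrow> complex \<times> complex"
    and a b :: "'n \<Rightarrow> (real \<Rightarrow> (complex \<times> complex) ^ 'n) set"
    and X :: "(real \<Rightarrow> (complex \<times> complex) ^ 'n) set set"
    and \<tau> :: "'n \<Rightarrow> 'n"
  defines "G \<equiv> pure_braid_group p"
  assumes base_point: "p \<in> config_space torus"
    and loops_a: "\<And>i. string_loop p i (torus_loop_a (p $ i)) (\<alpha> i)"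
    and loops_b: "\<And>i. string_loop p i (torus_loop_b (p $ i)) (\<beta> i)"
    and a: "\<And>i. a i = single_string_braid p i (\<alpha> i)"
    and b: "\<And>i. b i = single_string_braid p i (\<beta> i)"
    and generators: "finite X" "X \<subseteq> carrier G" "generate G X = carrier G"
    and perm: "bij \<tau>"
  shows "permute_character_sphere G a b \<tau> ` BNS_Sigma1 G X = BNS_Sigma1 G X \<and>
         permute_character_sphere G a b \<tau> ` (character_sphere G - BNS_Sigma1 G X)
           = character_sphere G - BNS_Sigma1 G X"
proof -
  interpret torus_braids p \<alpha> \<beta> a b
    by unfold_locales (fact base_point loops_a loops_b a b)+
  show ?thesis
    using permute_BNS[OF generators[unfolded G_def] perm] unfolding G_def .
qed

end
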